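(* If $G$ is a group with property (VRC), then every finitely generated virtually abelian subgroup of $G$ is a virtual retract of $G$.
   Context: A subgroup $H$ of a group $K$ is a retract of $K$ if there is a homomorphism $\rho: K \to H$ which restricts to the identity map on $H$. A subgroup $H$ of a group $G$ is a virtual retract of $G$ if there exists a subgroup $K \leqslant G$ with $|G:K|<\infty$, $H \subseteq K$, and $H$ a retract of $K$. A group $G$ has property (VRC) if every cyclic subgroup of $G$ is a virtual retract of $G$. A group is virtually abelian if it has an abelian subgroup of finite index. *)

theory Defs
  imports "HOL-Algebra.Algebra"
begin

text \<open>
  A subgroup \<open>H\<close> of \<open>G\<close> is a set; regarded as a group in its own right it is
  \<open>G\<lparr>carrier := H\<rparr>\<close>.
\<close>

definition finite_index :: "('a, 'b) monoid_scheme \<Rightarrow> 'a set \<Rightarrow> bool" where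
  "finite_index G H \<longleftrightarrow> subgroup H G \<and> finite (rcosets\<^bsub>G\<^esub> H)"

definition retract :: "('a, 'b) monoid_scheme \<Rightarrow> 'a set \<Rightarrow> bool" where
  "retract K H \<longleftrightarrow> subgroup H K \<and> (\<exists>\<rho> \<in> hom K (K\<lparr>carrier := H\<rparr>). \<forall>h\<in>H. \<rho> h = h)"

definition virtual_retract :: "('a, 'b) monoid_scheme \<Rightarrow> 'a set \<Rightarrow> bool" where
  "virtual_retract G H \<longleftrightarrow>
     subgroup H G \<and> (\<exists>K. finite_index G K \<and> H \<subseteq> K \<and> retract (G\<lparr>carrier := K\<rparr>) H)"

definition property_VRC :: "('a, 'b) monoid_scheme \<Rightarrow> bool" where
  "property_VRC G \<longleftrightarrow>
     (\<forall>C. subgroup C G \<longrightarrow> cyclic_group (G\<lparr>carrier := C\<rparr>) \<longrightarrow> virtual_retract G C)"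

definition finitely_generated_group :: "('a, 'b) monoid_scheme \<Rightarrow> bool" where
  "finitely_generated_group G \<longleftrightarrow>
     (\<exists>S. finite S \<and> S \<subseteq> carrier G \<and> generate G S = carrier G)"

definition virtually_abelian :: "('a, 'b) monoid_scheme \<Rightarrow> bool" where
  "virtually_abelian G \<longleftrightarrow> (\<exists>A. finite_index G A \<and> comm_group (G\<lparr>carrier := A\<rparr>))"

end

theory Submission
  imports Defs
begin

text \<open>
  Let \<open>H\<close> be finitely generated with a normal abelian subgroup \<open>C\<close> of finite index. Combining virtual
  retractions onto cyclic groups one generator at a time yields a torsion-free \<open>B \<le> C\<close> of finite index
  in \<open>H\<close> and a retraction \<open>f : K \<rightarrow> B\<close> with \<open>K\<close> of finite index in \<open>G\<close>. As \<open>G\<close> is residually finite,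
  \<open>K\<close> can be replaced by a normal subgroup on which the finite group \<open>ker f \<inter> H\<close> is trivial.
  Averaging \<open>f\<close> over the conjugation action of \<open>H\<close>, which factors through a finite quotient \<open>H / E\<close>,
  gives an \<open>H\<close>-equivariant map to \<open>C\<close> that is a power map on \<open>E\<close>. Its kernel \<open>M\<close> is normalised by
  \<open>H\<close>, meets \<open>H\<close> trivially, and \<open>M H\<close> has finite index in \<open>G\<close>; so \<open>M H = M \<rtimes> H\<close> retracts onto \<open>H\<close>.
\<close>

section \<open>Finite index as a relation between sets\<close>

text \<open>
  For a subgroup \<open>C\<close> this says that \<open>A\<close> meets only finitely many right cosets of \<open>C\<close>, with \<open>g\<close> a
  labelling that separates them; \<open>A\<close> need not contain \<open>C\<close>.
\<close>

definition fin_cosets :: "('a, 'b) monoid_scheme \<Rightarrow> 'a set \<Rightarrow> 'a set \<Rightarrow> bool" where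
  "fin_cosets G A C \<longleftrightarrow>
     (\<exists>g :: 'a \<Rightarrow> 'a set. finite (g ` A) \<and> (\<forall>x\<in>A. \<forall>y\<in>A. g x = g y \<longrightarrow> x \<otimes>\<^bsub>G\<^esub> inv\<^bsub>G\<^esub> y \<in> C))"

text \<open>The definition has to fix one type of labels. A labelling with values in any other type
  can be replaced by the map sending \<open>x\<close> to its fibre in \<open>A\<close>, which
  separates the same points; so pairs, functions or integers may serve as labels.\<close>

lemma fin_cosetsI:
  fixes g :: "'a \<Rightarrow> 'c"
  assumes "finite (g ` A)"
    and "\<And>x y. x \<in> A \<Longrightarrow> y \<in> A \<Longrightarrow> g x = g y \<Longrightarrow> x \<otimes>\<^bsub>G\<^esub> inv\<^bsub>G\<^esub> y \<in> C"
  shows "fin_cosets G A C"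
proof -
  let ?h = "\<lambda>x. {z \<in> A. g z = g x}"
  have "?h ` A = (\<lambda>c. {z \<in> A. g z = c}) ` g ` A" by auto
  then have "finite (?h ` A)" using assms(1) by simp
  moreover have "x \<otimes>\<^bsub>G\<^esub> inv\<^bsub>G\<^esub> y \<in> C" if "x \<in> A" "y \<in> A" "?h x = ?h y" for x y
    using assms(2)[of x y] that by blast
  ultimately show ?thesis unfolding fin_cosets_def by (intro exI[of _ ?h]) blast
qed

lemma fin_cosetsE:
  assumes "fin_cosets G A C"
  obtains g :: "'a \<Rightarrow> 'a set" where "finite (g ` A)"
    and "\<And>x y. x \<in> A \<Longrightarrow> y \<in> A \<Longrightarrow> g x = g y \<Longrightarrow> x \<otimes>\<^bsub>G\<^esub> inv\<^bsub>G\<^esub> y \<in> C"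
  using assms unfolding fin_cosets_def by blast

lemma fin_cosets_mono:
  assumes "fin_cosets G A C" "Y \<subseteq> A" "C \<subseteq> D"
  shows "fin_cosets G Y D"
proof -
  obtain g :: "'a \<Rightarrow> 'a set" where g: "finite (g ` A)"
    "\<And>x y. x \<in> A \<Longrightarrow> y \<in> A \<Longrightarrow> g x = g y \<Longrightarrow> x \<otimes>\<^bsub>G\<^esub> inv\<^bsub>G\<^esub> y \<in> C"
    using assms(1) by (rule fin_cosetsE) blast
  show ?thesis
  proof (rule fin_cosetsI)
    show "finite (g ` Y)" using g(1) assms(2) by (meson finite_subset image_mono)
  qed (use g(2) assms in blast)
qed

context group
begin

lemma inv_mult_cancel_left [simp]:
  "x \<in> carrier G \<Longrightarrow> y \<in> carrier G \<Longrightarrow> inv x \<otimes> (x \<otimes> y) = y"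
  "x \<in> carrier G \<Longrightarrow> y \<in> carrier G \<Longrightarrow> x \<otimes> (inv x \<otimes> y) = y"
  by (simp_all flip: m_assoc)

lemma subgroup_closed:
  assumes "subgroup A G"
  shows "\<one> \<in> A" "x \<in> A \<Longrightarrow> y \<in> A \<Longrightarrow> x \<otimes> y \<in> A" "x \<in> A \<Longrightarrow> inv x \<in> A"
    "x \<in> A \<Longrightarrow> x \<in> carrier G" "x \<in> A \<Longrightarrow> x [^] (n::nat) \<in> A" "x \<in> A \<Longrightarrow> x [^] (i::int) \<in> A"
  using assms subgroup.one_closed subgroup.m_closed subgroup.m_inv_closed subgroup.mem_carrier
    subgroup_int_pow_closed[OF assms, of x i] subgroup_int_pow_closed[OF assms, of x "int n"]
  by (auto simp: int_pow_int)

text \<open>The coset \<open>K #> x\<close> is itself a label, since \<open>K #> x = K #> y\<close>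
  exactly when \<open>x \<otimes> inv y\<close> lies in \<open>K\<close>. Conversely, one
  representative per label exhausts the cosets.\<close>

lemma finite_index_iff:
  assumes H: "subgroup H G" and K: "subgroup K G" and sub: "K \<subseteq> H"
  shows "finite_index (G\<lparr>carrier := H\<rparr>) K \<longleftrightarrow> fin_cosets G H K"
proof -
  have rc: "rcosets\<^bsub>G\<lparr>carrier := H\<rparr>\<^esub> K = (\<lambda>x. K #> x) ` H"
    by (auto simp: RCOSETS_def r_coset_def)
  have eq: "K #> x = K #> y \<longleftrightarrow> x \<otimes> inv y \<in> K" if "x \<in> carrier G" "y \<in> carrier G" for x y
  proof
    assume "K #> x = K #> y"
    then have "x \<in> K #> y" using rcos_self[OF that(1) K] by simp
    then show "x \<otimes> inv y \<in> K"
      using that subgroup_closed(4)[OF K] by (auto simp: r_coset_def m_assoc)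
  next
    assume "x \<otimes> inv y \<in> K"
    then have "x \<in> K #> y"
      using that by (auto simp: r_coset_def m_assoc intro!: bexI[of _ "x \<otimes> inv y"])
    then show "K #> x = K #> y" using repr_independence that K by blast
  qed
  have car: "x \<in> carrier G" if "x \<in> H" for x using subgroup_closed(4)[OF H that] .
  have "finite ((\<lambda>x. K #> x) ` H) \<longleftrightarrow> fin_cosets G H K"
  proof
    assume "finite ((\<lambda>x. K #> x) ` H)"
    then show "fin_cosets G H K" by (rule fin_cosetsI) (use eq car in blast)
  next
    assume "fin_cosets G H K"
    then obtain g :: "'a \<Rightarrow> 'a set" where g: "finite (g ` H)"
      "\<And>x y. x \<in> H \<Longrightarrow> y \<in> H \<Longrightarrow> g x = g y \<Longrightarrow> x \<otimes> inv y \<in> K"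
      by (rule fin_cosetsE) blast
    define r where "r = (\<lambda>c. SOME x. x \<in> H \<and> g x = c)"
    have r: "r (g x) \<in> H \<and> g (r (g x)) = g x" if "x \<in> H" for x
      unfolding r_def by (rule someI[of "\<lambda>z. z \<in> H \<and> g z = g x"]) (use that in simp)
    have "K #> x = K #> r (g x)" if "x \<in> H" for x
      using eq g(2) r[OF that] car that by metis
    then have "(\<lambda>x. K #> x) ` H = (\<lambda>c. K #> r c) ` g ` H" by (auto simp: image_image)
    then show "finite ((\<lambda>x. K #> x) ` H)" using g(1) by simp
  qed
  moreover have "subgroup K (G\<lparr>carrier := H\<rparr>)" using subgroup_incl K H sub by blast
  ultimately show ?thesis unfolding finite_index_def rc by simp
qed

lemma finite_index_iff_carrier:
  assumes "subgroup K G"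
  shows "finite_index G K \<longleftrightarrow> fin_cosets G (carrier G) K"
  using finite_index_iff[OF subgroup_self assms] subgroup.subset[OF assms] by simp

lemma fin_cosets_Int:
  assumes "fin_cosets G A C" "fin_cosets G A D"
  shows "fin_cosets G A (C \<inter> D)"
proof -
  obtain g :: "'a \<Rightarrow> 'a set" where g: "finite (g ` A)"
    "\<And>x y. x \<in> A \<Longrightarrow> y \<in> A \<Longrightarrow> g x = g y \<Longrightarrow> x \<otimes> inv y \<in> C"
    using assms(1) by (rule fin_cosetsE) blast
  obtain h :: "'a \<Rightarrow> 'a set" where h: "finite (h ` A)"
    "\<And>x y. x \<in> A \<Longrightarrow> y \<in> A \<Longrightarrow> h x = h y \<Longrightarrow> x \<otimes> inv y \<in> D"
    using assms(2) by (rule fin_cosetsE) blast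
  show ?thesis
  proof (rule fin_cosetsI)
    show "finite ((\<lambda>x. (g x, h x)) ` A)"
      by (rule finite_subset[of _ "g ` A \<times> h ` A"]) (use g(1) h(1) in auto)
  qed (use g(2) h(2) in auto)
qed

lemma fin_cosets_restrict:
  assumes "fin_cosets G A C" "Y \<subseteq> A" "subgroup Y G"
  shows "fin_cosets G Y (Y \<inter> C)"
proof -
  obtain g :: "'a \<Rightarrow> 'a set" where g: "finite (g ` A)"
    "\<And>x y. x \<in> A \<Longrightarrow> y \<in> A \<Longrightarrow> g x = g y \<Longrightarrow> x \<otimes> inv y \<in> C"
    using assms(1) by (rule fin_cosetsE) blast
  show ?thesis
  proof (rule fin_cosetsI)
    show "finite (g ` Y)" using g(1) assms(2) by (meson finite_subset image_mono)
    fix x y assume "x \<in> Y" "y \<in> Y" "g x = g y"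
    then show "x \<otimes> inv y \<in> Y \<inter> C"
      using g(2)[of x y] assms(2) subgroup_closed[OF assms(3)] by auto
  qed
qed

text \<open>Dividing \<open>x\<close> by the chosen representative \<open>s\<close> of its label
  modulo \<open>C\<close> moves it into \<open>C\<close>. The first label together with the label of
  \<open>x \<otimes> inv s\<close> modulo \<open>D\<close> separates, because \<open>s\<close>
  cancels for two elements that share the first label.\<close>

lemma fin_cosets_trans:
  assumes XC: "fin_cosets G A C" and CD: "fin_cosets G C D"
    and sub: "A \<subseteq> carrier G"
  shows "fin_cosets G A D"
proof -
  obtain g :: "'a \<Rightarrow> 'a set" where g: "finite (g ` A)"
    "\<And>x y. x \<in> A \<Longrightarrow> y \<in> A \<Longrightarrow> g x = g y \<Longrightarrow> x \<otimes> inv y \<in> C"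
    using XC by (rule fin_cosetsE) blast
  obtain h :: "'a \<Rightarrow> 'a set" where h: "finite (h ` C)"
    "\<And>x y. x \<in> C \<Longrightarrow> y \<in> C \<Longrightarrow> h x = h y \<Longrightarrow> x \<otimes> inv y \<in> D"
    using CD by (rule fin_cosetsE) blast
  define r where "r = (\<lambda>c. SOME x. x \<in> A \<and> g x = c)"
  have r: "r (g x) \<in> A \<and> g (r (g x)) = g x" if "x \<in> A" for x
    unfolding r_def by (rule someI[of "\<lambda>z. z \<in> A \<and> g z = g x"]) (use that in simp)
  have rC: "x \<otimes> inv (r (g x)) \<in> C" if "x \<in> A" for x
    using g(2)[of x "r (g x)"] r that by auto
  show ?thesis
  proof (rule fin_cosetsI)
    show "finite ((\<lambda>x. (g x, h (x \<otimes> inv (r (g x))))) ` A)"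
      by (rule finite_subset[of _ "g ` A \<times> h ` C"]) (use g(1) h(1) rC in auto)
    fix x y assume xy: "x \<in> A" "y \<in> A"
      "(g x, h (x \<otimes> inv (r (g x)))) = (g y, h (y \<otimes> inv (r (g y))))"
    define s where "s = r (g x)"
    have s: "s \<in> carrier G" "r (g y) = s" using r xy sub unfolding s_def by auto
    have "h (x \<otimes> inv s) = h (y \<otimes> inv s)" using xy(3) s(2) unfolding s_def by (metis prod.inject)
    moreover have "x \<otimes> inv s \<in> C" "y \<otimes> inv s \<in> C"
      using rC[OF xy(1)] rC[OF xy(2)] s(2) by (simp_all add: s_def)
    ultimately have "(x \<otimes> inv s) \<otimes> inv (y \<otimes> inv s) \<in> D" using h(2) by blast
    then show "x \<otimes> inv y \<in> D"
      using xy sub s(1) by (simp add: subset_iff inv_mult_group m_assoc)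
  qed
qed

section \<open>Homomorphisms on subgroups and finite index\<close>

lemma hom_subgroup:
  assumes "subgroup K G" "f \<in> hom (G\<lparr>carrier := K\<rparr>) G"
  shows "x \<in> K \<Longrightarrow> f x \<in> carrier G"
    "x \<in> K \<Longrightarrow> y \<in> K \<Longrightarrow> f (x \<otimes> y) = f x \<otimes> f y"
    "f \<one> = \<one>" "x \<in> K \<Longrightarrow> f (inv x) = inv (f x)"
    "x \<in> K \<Longrightarrow> f (x [^] (n::nat)) = f x [^] n"
    "x \<in> K \<Longrightarrow> f (x [^] (i::int)) = f x [^] i"
proof -
  interpret f: group_hom "G\<lparr>carrier := K\<rparr>" G f
    using assms by (simp add: group_hom_def group_hom_axioms_def subgroup_imp_group)
  show "x \<in> K \<Longrightarrow> f x \<in> carrier G" "x \<in> K \<Longrightarrow> y \<in> K \<Longrightarrow> f (x \<otimes> y) = f x \<otimes> f y"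
    "f \<one> = \<one>" using f.hom_closed f.hom_mult f.hom_one by auto
  show "x \<in> K \<Longrightarrow> f (inv x) = inv (f x)"
    using f.hom_inv[of x] m_inv_consistent[OF assms(1)] by simp
  show "x \<in> K \<Longrightarrow> f (x [^] (n::nat)) = f x [^] n"
    using f.hom_nat_pow[of x n] by (simp flip: nat_pow_consistent)
  show "x \<in> K \<Longrightarrow> f (x [^] (i::int)) = f x [^] i"
    using f.hom_int_pow[of x i] by (simp add: int_pow_consistent[OF assms(1)])
qed

lemma fin_cosets_vimage:
  assumes K: "subgroup K G" and f: "f \<in> hom (G\<lparr>carrier := K\<rparr>) G"
    and YE: "fin_cosets G Y E" and im: "f ` K \<subseteq> Y"
  shows "fin_cosets G K {k \<in> K. f k \<in> E}"
proof -
  obtain g :: "'a \<Rightarrow> 'a set" where g: "finite (g ` Y)"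
    "\<And>x y. x \<in> Y \<Longrightarrow> y \<in> Y \<Longrightarrow> g x = g y \<Longrightarrow> x \<otimes> inv y \<in> E"
    using YE by (rule fin_cosetsE) blast
  show ?thesis
  proof (rule fin_cosetsI)
    show "finite ((\<lambda>x. g (f x)) ` K)"
      by (rule finite_subset[of _ "g ` Y"]) (use g(1) im in auto)
    fix x y assume xy: "x \<in> K" "y \<in> K" "g (f x) = g (f y)"
    then have "f x \<otimes> inv (f y) \<in> E" using g(2)[of "f x" "f y"] im by blast
    then show "x \<otimes> inv y \<in> {k \<in> K. f k \<in> E}"
      using xy subgroup_closed[OF K] hom_subgroup[OF K f] by simp
  qed
qed

lemma fin_cosets_image:
  assumes K: "subgroup K G" and f: "f \<in> hom (G\<lparr>carrier := K\<rparr>) G" and KE: "fin_cosets G K E"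
  shows "fin_cosets G (f ` K) (f ` E)"
proof -
  obtain g :: "'a \<Rightarrow> 'a set" where g: "finite (g ` K)"
    "\<And>x y. x \<in> K \<Longrightarrow> y \<in> K \<Longrightarrow> g x = g y \<Longrightarrow> x \<otimes> inv y \<in> E"
    using KE by (rule fin_cosetsE) blast
  define s where "s = inv_into K f"
  have s: "s y \<in> K" "f (s y) = y" if "y \<in> f ` K" for y
    using that by (simp_all add: s_def inv_into_into f_inv_into_f)
  show ?thesis
  proof (rule fin_cosetsI)
    show "finite ((\<lambda>y. g (s y)) ` f ` K)"
      by (rule finite_subset[of _ "g ` K"]) (use g(1) s in auto)
    fix x y assume xy: "x \<in> f ` K" "y \<in> f ` K" "g (s x) = g (s y)"
    then have "s x \<otimes> inv (s y) \<in> E" using g(2) s by auto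
    moreover have "f (s x \<otimes> inv (s y)) = x \<otimes> inv y"
      using xy s subgroup_closed[OF K] hom_subgroup[OF K f] by simp
    ultimately show "x \<otimes> inv y \<in> f ` E" by (metis imageI)
  qed
qed

section \<open>Finiteness, powers and normal cores\<close>

text \<open>The labelling is injective on \<open>Y\<close>: two elements of \<open>Y\<close> with
  equal labels have their quotient in \<open>Y \<inter> C\<close>.\<close>

lemma fin_cosets_trivial_Int:
  assumes "fin_cosets G A C" "subgroup Y G" "Y \<subseteq> A" "Y \<inter> C \<subseteq> {\<one>}"
  shows "finite Y"
proof -
  obtain g :: "'a \<Rightarrow> 'a set" where g: "finite (g ` A)"
    "\<And>x y. x \<in> A \<Longrightarrow> y \<in> A \<Longrightarrow> g x = g y \<Longrightarrow> x \<otimes> inv y \<in> C"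
    using assms(1) by (rule fin_cosetsE) blast
  have "inj_on g Y"
  proof (rule inj_onI)
    fix x y assume xy: "x \<in> Y" "y \<in> Y" "g x = g y"
    then have "x \<otimes> inv y \<in> Y \<inter> C" using g(2) assms(3) subgroup_closed[OF assms(2)] by auto
    then have "x \<otimes> inv y = \<one>" using assms(4) by auto
    then show "x = y" using xy subgroup_closed(4)[OF assms(2)] by (simp add: inv_solve_right')
  qed
  moreover have "finite (g ` Y)" using g(1) assms(3) by (meson finite_subset image_mono)
  ultimately show ?thesis using finite_imageD by blast
qed

text \<open>By the pigeonhole principle two powers of \<open>x\<close> share a label, and their
  quotient is again a power of \<open>x\<close>.\<close>

lemma fin_cosets_pow:
  assumes XC: "fin_cosets G A C" and A: "subgroup A G" and x: "x \<in> A"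
  obtains n :: nat where "n > 0" "x [^] n \<in> C"
proof -
  obtain g :: "'a \<Rightarrow> 'a set" where g: "finite (g ` A)"
    "\<And>x y. x \<in> A \<Longrightarrow> y \<in> A \<Longrightarrow> g x = g y \<Longrightarrow> x \<otimes> inv y \<in> C"
    using XC by (rule fin_cosetsE) blast
  have xc: "x \<in> carrier G" using subgroup_closed(4)[OF A x] .
  have "finite ((\<lambda>n::nat. g (x [^] n)) ` UNIV)"
    by (rule finite_subset[of _ "g ` A"]) (use g(1) x subgroup_closed[OF A] in auto)
  then have "\<not> inj (\<lambda>n::nat. g (x [^] n))" using finite_imageD infinite_UNIV_nat by blast
  then obtain m n :: nat where mn: "m < n" "g (x [^] m) = g (x [^] n)"
    unfolding inj_def by (metis linorder_neqE_nat)
  then have "x [^] n \<otimes> inv (x [^] m) \<in> C" using g(2) x subgroup_closed[OF A] by metis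
  moreover have "x [^] n \<otimes> inv (x [^] m) = x [^] (n - m)"
    using nat_pow_mult[OF xc, of "n - m" m] mn(1) xc by (simp add: inv_solve_right')
  ultimately show ?thesis using that[of "n - m"] mn(1) by simp
qed

text \<open>\<open>N\<close> is the normal core of \<open>C\<close> in \<open>H\<close>. The new
  label of \<open>x\<close> is the table that records, for each old label \<open>c\<close> with
  representative \<open>r c\<close>, the old label of \<open>r c \<otimes> x\<close>; only finitely
  many tables exist.\<close>

lemma fin_cosets_core:
  assumes H: "subgroup H G" and C: "subgroup C G" and sub: "C \<subseteq> H" and HC: "fin_cosets G H C"
  obtains N where "subgroup N G" "N \<subseteq> C" "fin_cosets G H N"
    "\<And>x z. x \<in> N \<Longrightarrow> z \<in> H \<Longrightarrow> z \<otimes> x \<otimes> inv z \<in> N"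
proof -
  define N where "N = {x \<in> H. \<forall>z\<in>H. z \<otimes> x \<otimes> inv z \<in> C}"
  note Hc = subgroup_closed[OF H] and Cc = subgroup_closed[OF C]
  obtain g :: "'a \<Rightarrow> 'a set" where g: "finite (g ` H)"
    "\<And>x y. x \<in> H \<Longrightarrow> y \<in> H \<Longrightarrow> g x = g y \<Longrightarrow> x \<otimes> inv y \<in> C"
    using HC by (rule fin_cosetsE) blast
  have "subgroup N G"
  proof (rule subgroupI)
    show "N \<subseteq> carrier G" using Hc(4) N_def by auto
    show "N \<noteq> {}" using Hc Cc(1) unfolding N_def by force
    fix a assume a: "a \<in> N"
    have "z \<otimes> inv a \<otimes> inv z \<in> C" if z: "z \<in> H" for z
    proof -
      have "inv (z \<otimes> a \<otimes> inv z) \<in> C" using a z Cc(3) unfolding N_def by auto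
      then show ?thesis using a z Hc(4) unfolding N_def by (simp add: inv_mult_group m_assoc)
    qed
    then show "inv a \<in> N" using a Hc unfolding N_def by auto
    fix b assume b: "b \<in> N"
    have "z \<otimes> (a \<otimes> b) \<otimes> inv z \<in> C" if z: "z \<in> H" for z
    proof -
      have "(z \<otimes> a \<otimes> inv z) \<otimes> (z \<otimes> b \<otimes> inv z) \<in> C" using a b z Cc(2) unfolding N_def by auto
      then show ?thesis using a b z Hc(4) unfolding N_def by (simp add: m_assoc)
    qed
    then show "a \<otimes> b \<in> N" using a b Hc unfolding N_def by auto
  qed
  moreover have "N \<subseteq> C"
  proof
    fix x assume "x \<in> N"
    then have "x \<in> H" "\<one> \<otimes> x \<otimes> inv \<one> \<in> C" using Hc(1) unfolding N_def by blast+
    then show "x \<in> C" using Hc(4) by simp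
  qed
  moreover have "z \<otimes> x \<otimes> inv z \<in> N" if x: "x \<in> N" and z: "z \<in> H" for x z
  proof -
    have "w \<otimes> (z \<otimes> x \<otimes> inv z) \<otimes> inv w \<in> C" if w: "w \<in> H" for w
    proof -
      have "(w \<otimes> z) \<otimes> x \<otimes> inv (w \<otimes> z) \<in> C" using x z w Hc(2) unfolding N_def by auto
      then show ?thesis using x z w Hc(4) unfolding N_def by (simp add: inv_mult_group m_assoc)
    qed
    then show ?thesis using x z Hc unfolding N_def by auto
  qed
  moreover have "fin_cosets G H N"
  proof -
    define r where "r = (\<lambda>c. SOME x. x \<in> H \<and> g x = c)"
    have r: "r c \<in> H \<and> g (r c) = c" if c: "c \<in> g ` H" for c
      unfolding r_def by (rule someI_ex) (use c in auto)
    define h where "h = (\<lambda>x. \<lambda>c\<in>g ` H. g (r c \<otimes> x))"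
    show ?thesis
    proof (rule fin_cosetsI)
      show "finite (h ` H)"
        by (rule finite_subset[of _ "g ` H \<rightarrow>\<^sub>E g ` H"])
          (use g(1) r Hc(2) in \<open>auto simp: h_def intro!: finite_PiE\<close>)
      fix x y assume x: "x \<in> H" and y: "y \<in> H" and eq: "h x = h y"
      have "z \<otimes> (x \<otimes> inv y) \<otimes> inv z \<in> C" if z: "z \<in> H" for z
      proof -
        define w where "w = r (g z)"
        have w: "w \<in> H" "g w = g z" using r z unfolding w_def by auto
        have "g (w \<otimes> x) = g (w \<otimes> y)"
          using fun_cong[OF eq, of "g z"] z unfolding h_def w_def by simp
        then have 1: "(w \<otimes> x) \<otimes> inv (w \<otimes> y) \<in> C" using g(2)[of "w \<otimes> x" "w \<otimes> y"] w x y Hc(2) by simp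
        have 2: "z \<otimes> inv w \<in> C" using g(2)[of z w] w z by simp
        \<comment> \<open>The tables compare translates of the representatives \<open>w\<close>
          only; conjugating by \<open>z \<otimes> inv w\<close>, an element of \<open>C\<close>,
          passes to an arbitrary \<open>z\<close>.\<close>
        have "(z \<otimes> inv w) \<otimes> ((w \<otimes> x) \<otimes> inv (w \<otimes> y)) \<otimes> inv (z \<otimes> inv w) \<in> C"
          using Cc(2)[OF Cc(2)[OF 2 1] Cc(3)[OF 2]] .
        then show ?thesis using w z x y Hc(4) by (simp add: inv_mult_group m_assoc)
      qed
      then show "x \<otimes> inv y \<in> N" using x y Hc unfolding N_def by auto
    qed
  qed
  ultimately show ?thesis using that by blast
qed

end

section \<open>Virtual retractions and products of subgroups\<close>

text \<open>Both witnesses of a virtual retract are named, so that they can be modified later. The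
  map goes into \<open>G\<close> and its image is bounded separately, which avoids changes of
  carrier; as \<open>f\<close> fixes \<open>B\<close> pointwise, its image is exactly
  \<open>B\<close>.\<close>

definition virtual_retraction ::
    "('a, 'b) monoid_scheme \<Rightarrow> 'a set \<Rightarrow> 'a set \<Rightarrow> ('a \<Rightarrow> 'a) \<Rightarrow> bool" where
  "virtual_retraction G K B f \<longleftrightarrow>
     subgroup K G \<and> fin_cosets G (carrier G) K \<and> B \<subseteq> K \<and>
     f \<in> hom (G\<lparr>carrier := K\<rparr>) G \<and> f ` K \<subseteq> B \<and> (\<forall>b\<in>B. f b = b)"

definition torsion_free :: "('a, 'b) monoid_scheme \<Rightarrow> 'a set \<Rightarrow> bool" where
  "torsion_free G B \<longleftrightarrow> (\<forall>x\<in>B. \<forall>n::nat. n > 0 \<longrightarrow> x [^]\<^bsub>G\<^esub> n = \<one>\<^bsub>G\<^esub> \<longrightarrow> x = \<one>\<^bsub>G\<^esub>)"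

context group
begin

lemma subgroup_set_mult:
  assumes A: "subgroup A G" and B: "subgroup B G"
    and norm: "\<And>a b. a \<in> A \<Longrightarrow> b \<in> B \<Longrightarrow> b \<otimes> a \<otimes> inv b \<in> A"
  shows "subgroup (A <#> B) G"
proof (rule subgroupI)
  note Ac = subgroup_closed[OF A] and Bc = subgroup_closed[OF B]
  show "A <#> B \<subseteq> carrier G" using Ac(4) Bc(4) by (auto simp: set_mult_def)
  show "A <#> B \<noteq> {}" using Ac(1) Bc(1) by (auto simp: set_mult_def)
  fix x assume "x \<in> A <#> B"
  then obtain a b where x: "x = a \<otimes> b" "a \<in> A" "b \<in> B" by (auto simp: set_mult_def)
  have "inv x = (inv b \<otimes> inv a \<otimes> inv (inv b)) \<otimes> inv b"
    using x Ac(4) Bc(4) by (simp add: inv_mult_group m_assoc)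
  then show "inv x \<in> A <#> B"
    using norm[OF Ac(3)[OF x(2)] Bc(3)[OF x(3)]] Bc(3)[OF x(3)] unfolding set_mult_def by blast
  fix y assume "y \<in> A <#> B"
  then obtain c d where y: "y = c \<otimes> d" "c \<in> A" "d \<in> B" by (auto simp: set_mult_def)
  have "x \<otimes> y = (a \<otimes> (b \<otimes> c \<otimes> inv b)) \<otimes> (b \<otimes> d)"
    using x y Ac(4) Bc(4) by (simp add: inv_mult_group m_assoc)
  then show "x \<otimes> y \<in> A <#> B"
    using Ac(2)[OF x(2) norm[OF y(2) x(3)]] Bc(2)[OF x(3) y(3)] unfolding set_mult_def by blast
qed

lemma mem_set_mult:
  assumes "subgroup A G" "subgroup B G"
  shows "a \<in> A \<Longrightarrow> a \<in> A <#> B" "b \<in> B \<Longrightarrow> b \<in> A <#> B"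
    "a \<in> A \<Longrightarrow> b \<in> B \<Longrightarrow> a \<otimes> b \<in> A <#> B"
proof -
  note Ac = subgroup_closed[OF assms(1)] and Bc = subgroup_closed[OF assms(2)]
  have mult: "x \<otimes> y \<in> A <#> B" if "x \<in> A" "y \<in> B" for x y
    using that by (auto simp: set_mult_def)
  show "a \<in> A \<Longrightarrow> b \<in> B \<Longrightarrow> a \<otimes> b \<in> A <#> B" by (rule mult)
  show "a \<in> A \<Longrightarrow> a \<in> A <#> B" using mult[of a \<one>] Ac(4) Bc(1) by simp
  show "b \<in> B \<Longrightarrow> b \<in> A <#> B" using mult[of \<one> b] Bc(4) Ac(1) by simp
qed

lemma generate_singleton:
  assumes "x \<in> carrier G"
  shows "subgroup (generate G {x}) G" "x \<in> generate G {x}"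
    "y \<in> generate G {x} \<longleftrightarrow> (\<exists>i::int. y = x [^] i)"
  using assms generate_is_subgroup[of "{x}"] generate.incl[of x "{x}" G]
  by (auto simp: generate_pow)

text \<open>Elements of the product have the form \<open>a \<otimes> c [^] i\<close> and are
  labelled by the label of \<open>a\<close> together with \<open>i\<close> modulo \<open>n\<close>.
  Since \<open>C\<close> is abelian, the quotient of two elements with equal labels is an element of
  \<open>E\<close> times a power of \<open>c [^] n\<close>, and both factors lie in
  \<open>D\<close>.\<close>

lemma fin_cosets_adjoin:
  fixes n :: nat
  assumes C: "subgroup C G" and comm: "\<And>x y. x \<in> C \<Longrightarrow> y \<in> C \<Longrightarrow> x \<otimes> y = y \<otimes> x"
    and A: "subgroup A G" "A \<subseteq> C" and AE: "fin_cosets G A E" and D: "subgroup D G" "E \<subseteq> D"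
    and c: "c \<in> C" "c [^] n \<in> D" "n > 0"
  shows "fin_cosets G (A <#> generate G {c}) D"
proof -
  note Cc = subgroup_closed[OF C]
  have car: "c \<in> carrier G" using Cc(4) c(1) .
  have Acar: "x \<in> carrier G" if "x \<in> A" for x using subgroup_closed(4)[OF A(1) that] .
  obtain g :: "'a \<Rightarrow> 'a set" where g: "finite (g ` A)"
    "\<And>x y. x \<in> A \<Longrightarrow> y \<in> A \<Longrightarrow> g x = g y \<Longrightarrow> x \<otimes> inv y \<in> E"
    using AE by (rule fin_cosetsE) blast
  have "\<exists>a i. x = a \<otimes> c [^] (i::int) \<and> a \<in> A" if x: "x \<in> A <#> generate G {c}" for x
  proof -
    obtain a b where "a \<in> A" "b \<in> generate G {c}" "x = a \<otimes> b"
      using x by (auto simp: set_mult_def)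
    then show ?thesis using generate_singleton(3)[OF car, of b] by auto
  qed
  then obtain a and i :: "'a \<Rightarrow> int"
    where ai: "\<And>x. x \<in> A <#> generate G {c} \<Longrightarrow> x = a x \<otimes> c [^] i x \<and> a x \<in> A" by metis
  show ?thesis
  proof (rule fin_cosetsI)
    show "finite ((\<lambda>x. (g (a x), i x mod int n)) ` (A <#> generate G {c}))"
      by (rule finite_subset[of _ "g ` A \<times> {0..<int n}"]) (use g(1) ai c(3) in auto)
    fix x y assume x: "x \<in> A <#> generate G {c}" and y: "y \<in> A <#> generate G {c}"
      and "(g (a x), i x mod int n) = (g (a y), i y mod int n)"
    then have eq: "g (a x) = g (a y)" "i x mod int n = i y mod int n" by auto
    have ax: "a x \<in> A" and ay: "a y \<in> A" using ai x y by auto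
    obtain q where q: "i x - i y = int n * q"
      using eq(2) by (metis dvdE mod_eq_dvd_iff)
    have "c [^] (i x - i y) = (c [^] n) [^] q"
      unfolding q using int_pow_pow[OF car, of "int n" q] by (simp add: int_pow_int)
    then have 1: "c [^] (i x - i y) \<in> D" using subgroup_closed(6)[OF D(1) c(2)] by simp
    have 2: "a x \<otimes> inv (a y) \<in> D" using g(2)[OF ax ay eq(1)] D(2) by blast
    have "x \<otimes> inv y = (a x \<otimes> c [^] i x) \<otimes> inv (a y \<otimes> c [^] i y)" using ai x y by auto
    also have "\<dots> = a x \<otimes> (c [^] i x \<otimes> inv (c [^] i y) \<otimes> inv (a y))"
      using ax ay Acar car by (simp add: inv_mult_group m_assoc)
    also have "\<dots> = a x \<otimes> (inv (a y) \<otimes> (c [^] i x \<otimes> inv (c [^] i y)))"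
      by (subst comm[of "c [^] i x \<otimes> inv (c [^] i y)"]) (use Cc c(1) ay A(2) in auto)
    also have "\<dots> = (a x \<otimes> inv (a y)) \<otimes> c [^] (i x - i y)"
      using ax ay Acar car by (simp add: m_assoc int_pow_diff)
    finally show "x \<otimes> inv y \<in> D" using subgroup_closed(2)[OF D(1) 2 1] by simp
  qed
qed

section \<open>Cyclic virtual retracts and residual finiteness\<close>

lemma VRC_cyclic:
  assumes "property_VRC G" "x \<in> carrier G"
  obtains K f where "virtual_retraction G K (generate G {x}) f"
proof -
  let ?C = "generate G {x}"
  note C = generate_singleton[OF assms(2)]
  interpret C: group "G\<lparr>carrier := ?C\<rparr>" using C(1) by (rule subgroup_imp_group)
  have "cyclic_group (G\<lparr>carrier := ?C\<rparr>)"
    unfolding C.cyclic_group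
  proof (rule bexI[of _ x])
    show "carrier (G\<lparr>carrier := ?C\<rparr>) = range (\<lambda>n::int. x [^]\<^bsub>G\<lparr>carrier := ?C\<rparr>\<^esub> n)"
      using C(3) int_pow_consistent[OF C(1) C(2)] by auto
  qed (use C(2) in simp)
  then have "virtual_retract G ?C" using assms(1) C(1) unfolding property_VRC_def by blast
  then obtain K f where K: "finite_index G K" "?C \<subseteq> K"
    and f: "f \<in> hom (G\<lparr>carrier := K\<rparr>) (G\<lparr>carrier := K, carrier := ?C\<rparr>)" "\<forall>h\<in>?C. f h = h"
    unfolding virtual_retract_def retract_def by auto
  have sK: "subgroup K G" using K(1) unfolding finite_index_def by blast
  have "f \<in> hom (G\<lparr>carrier := K\<rparr>) G" "f ` K \<subseteq> ?C"
    using f(1) subgroup.subset[OF C(1)] unfolding hom_def by auto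
  then have "virtual_retraction G K ?C f"
    unfolding virtual_retraction_def using K f(2) sK finite_index_iff_carrier[OF sK] by blast
  then show ?thesis by (rule that)
qed

text \<open>A virtual retraction \<open>f\<close> onto the cyclic group of \<open>x\<close> reduces
  the claim to that group: a finite-index subgroup of it missing \<open>x\<close> is pulled back
  along \<open>f\<close>, and the preimage still misses \<open>x\<close> because \<open>f\<close>
  fixes \<open>x\<close>.\<close>

lemma VRC_residually_finite:
  assumes vrc: "property_VRC G" and x: "x \<in> carrier G" "x \<noteq> \<one>"
  obtains K where "subgroup K G" "fin_cosets G (carrier G) K" "x \<notin> K"
proof -
  let ?C = "generate G {x}"
  note C = generate_singleton[OF x(1)]
  obtain K f where Kf: "virtual_retraction G K ?C f" using VRC_cyclic[OF vrc x(1)] .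
  then have K: "subgroup K G" "fin_cosets G (carrier G) K" "?C \<subseteq> K"
    and f: "f \<in> hom (G\<lparr>carrier := K\<rparr>) G" "f ` K \<subseteq> ?C" "\<And>b. b \<in> ?C \<Longrightarrow> f b = b"
    unfolding virtual_retraction_def by auto
  \<comment> \<open>\<open>ord x = 0\<close> encodes infinite order, and then \<open>x\<close> is
    not a power of its square. For finite order \<open>x [^] n\<close> is \<open>\<one>\<close>, so
    \<open>?E\<close> is trivial.\<close>
  define n where "n = (if ord x = 0 then 2 else ord x)"
  let ?E = "generate G {x [^] n}"
  have xn: "x [^] n \<in> carrier G" using x(1) by simp
  note E = generate_singleton[OF xn]
  have comm: "a \<otimes> b = b \<otimes> a" if "a \<in> ?C" "b \<in> ?C" for a b
    using that x(1) unfolding C(3) by (auto simp: int_pow_mult[symmetric] add.commute)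
  have triv: "subgroup {\<one>} G" by (rule triv_subgroup)
  \<comment> \<open>The group \<open>?C\<close> arises from the trivial group by adjoining
    \<open>x\<close>, and \<open>x [^] n\<close> lies in \<open>?E\<close>; hence \<open>?E\<close>
    has finite index in \<open>?C\<close>.\<close>
  have "fin_cosets G ({\<one>} <#> ?C) ?E"
  proof (rule fin_cosets_adjoin[OF C(1) comm triv])
    show "fin_cosets G {\<one>} {\<one>}" by (rule fin_cosetsI[of "\<lambda>x. x"]) auto
  qed (use C E subgroup_closed(1)[OF C(1)] subgroup_closed(1)[OF E(1)] in \<open>auto simp: n_def\<close>)
  then have "fin_cosets G ?C ?E"
    by (rule fin_cosets_mono) (use mem_set_mult(2)[OF triv C(1)] in auto)
  then have "fin_cosets G K {k \<in> K. f k \<in> ?E}"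
    by (rule fin_cosets_vimage[OF K(1) f(1) _ f(2)])
  then have "fin_cosets G (carrier G) {k \<in> K. f k \<in> ?E}"
    by (rule fin_cosets_trans[OF K(2)]) simp
  moreover have "subgroup {k \<in> K. f k \<in> ?E} G"
    by (rule subgroupI)
      (use subgroup_closed[OF K(1)] subgroup_closed[OF E(1)] hom_subgroup[OF K(1) f(1)] in auto)
  moreover have "x \<notin> ?E"
  proof
    assume "x \<in> ?E"
    then obtain i :: int where i: "x = (x [^] n) [^] i" unfolding E(3) by blast
    then have "x [^] (int n * i - 1) = \<one>"
      using x(1) int_pow_pow[OF x(1), of "int n" i] by (simp add: int_pow_diff int_pow_int)
    then have dv: "int (ord x) dvd int n * i - 1" using int_pow_eq_id[OF x(1)] by blast
    show False
    proof (cases "ord x = 0")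
      case True
      then have "2 * i = 1" using dv by (simp add: n_def)
      then show False by presburger
    next
      case False
      then have "int (ord x) dvd int (ord x) * i - 1" using dv by (simp add: n_def)
      then have "int (ord x) dvd int (ord x) * i - (int (ord x) * i - 1)"
        by (rule dvd_diff[OF dvd_triv_left])
      then have "int (ord x) dvd 1" by simp
      then have "ord x = 1" by simp
      then show False using x ord_eq_1 by blast
    qed
  qed
  then have "x \<notin> {k \<in> K. f k \<in> ?E}" using f(3)[OF C(2)] by simp
  ultimately show ?thesis using that by blast
qed

lemma VRC_separates_finite:
  assumes vrc: "property_VRC G" and F: "finite F" "F \<subseteq> carrier G"
  obtains K where "subgroup K G" "fin_cosets G (carrier G) K" "K \<inter> F \<subseteq> {\<one>}"
proof -
  have "\<exists>K. subgroup K G \<and> fin_cosets G (carrier G) K \<and> K \<inter> F \<subseteq> {\<one>}"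
    using F
  proof (induction rule: finite_induct)
    case empty
    have "fin_cosets G (carrier G) (carrier G)" 
      by (rule fin_cosetsI[of "\<lambda>x. \<one>"]) (auto simp: image_constant_conv)
    then show ?case using subgroup_self by blast
  next
    case (insert x F)
    then obtain K where K: "subgroup K G" "fin_cosets G (carrier G) K" "K \<inter> F \<subseteq> {\<one>}" by blast
    show ?case
    proof (cases "x = \<one>")
      case True
      then show ?thesis using K by blast
    next
      case False
      then obtain L where L: "subgroup L G" "fin_cosets G (carrier G) L" "x \<notin> L"
        using VRC_residually_finite[OF vrc] insert.prems by blast
      have "K \<inter> L \<inter> insert x F \<subseteq> {\<one>}" using K(3) L(3) by blast
      then show ?thesis
        using subgroups_Inter_pair[OF K(1) L(1)] fin_cosets_Int[OF K(2) L(2)] by blast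
    qed
  qed
  then show ?thesis using that by blast
qed

section \<open>Schreier generators\<close>

text \<open>Schreier's argument: for a representative \<open>t\<close> modulo \<open>C\<close> and a
  generator or inverse generator \<open>s\<close>, the product \<open>t \<otimes> s\<close> equals
  \<open>u \<otimes> t'\<close> with \<open>u\<close> in \<open>U\<close> and \<open>t'\<close> in
  the finite set \<open>T\<close>. Pushing a word through \<open>T\<close> letter by letter places
  \<open>H\<close> inside \<open>A <#> T\<close> for every subgroup \<open>A\<close> containing
  \<open>U\<close>.\<close>

lemma fin_cosets_Schreier:
  assumes S: "finite S" "S \<subseteq> carrier G" and C: "subgroup C G" "C \<subseteq> generate G S"
    and HC: "fin_cosets G (generate G S) C"
  obtains U where "finite U" "U \<subseteq> C"
    "\<And>A. subgroup A G \<Longrightarrow> U \<subseteq> A \<Longrightarrow> fin_cosets G (generate G S) A"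
proof -
  define H where "H = generate G S"
  have H: "subgroup H G" unfolding H_def using S(2) by (rule generate_is_subgroup)
  note Hc = subgroup_closed[OF H]
  obtain g :: "'a \<Rightarrow> 'a set" where g: "finite (g ` H)"
    "\<And>x y. x \<in> H \<Longrightarrow> y \<in> H \<Longrightarrow> g x = g y \<Longrightarrow> x \<otimes> inv y \<in> C"
    using HC unfolding H_def by (rule fin_cosetsE) blast
  define r where "r = (\<lambda>c. SOME x. x \<in> H \<and> g x = c)"
  have r: "r (g x) \<in> H \<and> g (r (g x)) = g x" if "x \<in> H" for x
    unfolding r_def by (rule someI[of "\<lambda>z. z \<in> H \<and> g z = g x"]) (use that in simp)
  \<comment> \<open>The element \<open>\<one>\<close> is added so that the rewriting of a word can
    start from \<open>\<one> \<otimes> \<one>\<close>.\<close>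
  define T where "T = insert \<one> (r ` g ` H)"
  define S' where "S' = S \<union> m_inv G ` S"
  define U where "U = {t \<otimes> s \<otimes> inv t' | t s t'. t \<in> T \<and> s \<in> S' \<and> t' \<in> T \<and> t \<otimes> s \<otimes> inv t' \<in> C}"
  have T: "finite T" "T \<subseteq> H" using g(1) r Hc(1) unfolding T_def by auto
  have S': "finite S'" "S' \<subseteq> H"
    using S(1) generate.incl[of _ S G] generate.inv[of _ S G] unfolding S'_def H_def by auto
  have "U \<subseteq> (\<lambda>(t, s, t'). t \<otimes> s \<otimes> inv t') ` (T \<times> S' \<times> T)" unfolding U_def by force
  then have "finite U" by (rule finite_subset) (use T S' in auto)
  moreover have "U \<subseteq> C" unfolding U_def by blast
  moreover have "fin_cosets G H A" if A: "subgroup A G" and UA: "U \<subseteq> A" for A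
  proof -
    note Ac = subgroup_closed[OF A]
    have step: "\<exists>a\<in>A. \<exists>t\<in>T. x \<otimes> s = a \<otimes> t"
      if x: "a \<in> A" "t \<in> T" "x = a \<otimes> t" and s: "s \<in> S'" for x a t s
    proof -
      have ts: "t \<otimes> s \<in> H" using x(2) s T(2) S'(2) Hc(2) by blast
      define t' where "t' = r (g (t \<otimes> s))"
      have t': "t' \<in> T" "t' \<in> H" "g (t \<otimes> s) = g t'" using r[OF ts] ts unfolding t'_def T_def by auto
      then have "t \<otimes> s \<otimes> inv t' \<in> C" using g(2)[OF ts] by blast
      then have "t \<otimes> s \<otimes> inv t' \<in> A" using UA x(2) s t'(1) unfolding U_def by blast
      then have "a \<otimes> (t \<otimes> s \<otimes> inv t') \<in> A" using Ac(2) x(1) by blast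
      moreover have "x \<otimes> s = (a \<otimes> (t \<otimes> s \<otimes> inv t')) \<otimes> t'"
        using x s t'(2) T(2) S'(2) Hc(4) Ac(4) by (simp add: m_assoc subset_iff)
      ultimately show ?thesis using t'(1) by blast
    qed
    \<comment> \<open>The prefix \<open>a \<otimes> t\<close> is arbitrary, so that a product of two
      words can be absorbed one factor after the other.\<close>
    have right: "\<exists>a'\<in>A. \<exists>t'\<in>T. a \<otimes> t \<otimes> x = a' \<otimes> t'"
      if "x \<in> generate G S" "a \<in> A" "t \<in> T" for x a t
      using that
    proof (induction arbitrary: a t rule: generate.induct)
      case one
      then show ?case using Ac(4) T(2) Hc(4) by (metis m_closed r_one subsetD)
    next
      case (incl h)
      then show ?case using step[of a t _ h] unfolding S'_def by blast
    next
      case (inv h)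
      then show ?case using step[of a t _ "inv h"] unfolding S'_def by blast
    next
      case (eng h1 h2)
      obtain a1 t1 where 1: "a1 \<in> A" "t1 \<in> T" "a \<otimes> t \<otimes> h1 = a1 \<otimes> t1" using eng by metis
      obtain a2 t2 where 2: "a2 \<in> A" "t2 \<in> T" "a1 \<otimes> t1 \<otimes> h2 = a2 \<otimes> t2" using eng 1 by metis
      have "a \<otimes> t \<otimes> (h1 \<otimes> h2) = a \<otimes> t \<otimes> h1 \<otimes> h2"
        using eng Hc(4) Ac(4) T(2) unfolding H_def by (simp add: m_assoc subset_iff)
      then show ?case using 1 2 by metis
    qed
    have "\<exists>t. t \<in> T \<and> (\<exists>a\<in>A. x = a \<otimes> t)" if "x \<in> H" for x
      using right[of x \<one> \<one>] that Ac(1) Hc(4) unfolding H_def T_def by auto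
    then obtain \<tau> where \<tau>: "\<And>x. x \<in> H \<Longrightarrow> \<tau> x \<in> T \<and> (\<exists>a\<in>A. x = a \<otimes> \<tau> x)" by metis
    show ?thesis
    proof (rule fin_cosetsI)
      show "finite (\<tau> ` H)" by (rule finite_subset[of _ T]) (use \<tau> T in auto)
      fix x y assume xy: "x \<in> H" "y \<in> H" "\<tau> x = \<tau> y"
      obtain a where a: "a \<in> A" "x = a \<otimes> \<tau> y" using \<tau>[OF xy(1)] xy(3) by auto
      obtain b where b: "b \<in> A" "y = b \<otimes> \<tau> y" using \<tau>[OF xy(2)] by auto
      have ty: "\<tau> y \<in> carrier G" using \<tau>[OF xy(2)] T(2) Hc(4) by blast
      have "x \<otimes> inv y = (a \<otimes> \<tau> y) \<otimes> inv (b \<otimes> \<tau> y)" using a(2) b(2) by simp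
      also have "\<dots> = a \<otimes> inv b" using a(1) b(1) ty Ac(4) by (simp add: inv_mult_group m_assoc)
      finally show "x \<otimes> inv y \<in> A" using Ac a(1) b(1) by simp
    qed
  qed
  ultimately show ?thesis using that unfolding H_def by blast
qed

section \<open>Retracting onto abelian subgroups generator by generator\<close>

lemma hom_image_subgroup:
  assumes "subgroup K G" "f \<in> hom (G\<lparr>carrier := K\<rparr>) G"
  shows "subgroup (f ` K) G"
proof -
  interpret f: group_hom "G\<lparr>carrier := K\<rparr>" G f
    using assms by (simp add: group_hom_def group_hom_axioms_def subgroup_imp_group)
  show ?thesis using f.img_is_subgroup by simp
qed

lemma pow_hom:
  assumes "subgroup A G" and comm: "\<And>x y. x \<in> A \<Longrightarrow> y \<in> A \<Longrightarrow> x \<otimes> y = y \<otimes> x"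
  shows "(\<lambda>x. x [^] (n::nat)) \<in> hom (G\<lparr>carrier := A\<rparr>) G"
  using subgroup_closed(4)[OF assms(1)] pow_mult_distrib[OF comm] by (auto simp: hom_def)

text \<open>
  Induction on \<open>U\<close>. Given the retraction \<open>f : K \<rightarrow> B\<close> for the old generators, some power
  \<open>c\<^sup>j\<close> of the new one lies in \<open>K\<close>, and \<open>d = c\<^sup>j f(c\<^sup>j)\<inverse>\<close> lies in the kernel of \<open>f\<close>. If \<open>d\<close> has
  infinite order and \<open>r\<close> is a virtual retraction onto \<open>\<langle>d\<rangle>\<close>, then \<open>k \<mapsto> f(k) r(k) r(f(k))\<inverse>\<close> fixes both
  \<open>d\<close> and the elements of \<open>B\<close> in its domain.
\<close>

lemma VRC_abelian:
  assumes vrc: "property_VRC G"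
    and C: "subgroup C G" and comm: "\<And>x y. x \<in> C \<Longrightarrow> y \<in> C \<Longrightarrow> x \<otimes> y = y \<otimes> x"
    and U: "finite U" "U \<subseteq> C"
  shows "\<exists>A B K f. subgroup A G \<and> U \<subseteq> A \<and> A \<subseteq> C \<and>
    (\<forall>n::nat. n > 0 \<longrightarrow> fin_cosets G A ((\<lambda>x. x [^] n) ` A)) \<and>
    subgroup B G \<and> B \<subseteq> A \<and> fin_cosets G A B \<and> torsion_free G B \<and> virtual_retraction G K B f"
  using U
proof (induction rule: finite_induct)
  case empty
  have "fin_cosets G (carrier G) (carrier G)"
    by (rule fin_cosetsI[of "\<lambda>x. \<one>"]) (auto simp: image_constant_conv)
  moreover have "(\<lambda>_. \<one>) \<in> hom (G\<lparr>carrier := carrier G\<rparr>) G" by (simp add: hom_def)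
  ultimately have vr: "virtual_retraction G (carrier G) {\<one>} (\<lambda>_. \<one>)"
    unfolding virtual_retraction_def using subgroup_self by auto
  have fc: "fin_cosets G {\<one>} {\<one>}" by (rule fin_cosetsI[of "\<lambda>x. x"]) auto
  have "\<forall>n::nat. n > 0 \<longrightarrow> fin_cosets G {\<one>} ((\<lambda>x. x [^] n) ` {\<one>})" using fc by simp
  moreover have "torsion_free G {\<one>}" by (simp add: torsion_free_def)
  ultimately show ?case using fc vr triv_subgroup subgroup_closed(1)[OF C]
    by (intro exI[of _ "{\<one>}"] exI[of _ "carrier G"] exI[of _ "\<lambda>_. \<one>"]) simp
next
  case (insert c U)
  then obtain A B K f where A: "subgroup A G" "U \<subseteq> A" "A \<subseteq> C"
    and pow: "\<And>n::nat. n > 0 \<Longrightarrow> fin_cosets G A ((\<lambda>x. x [^] n) ` A)"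
    and B: "subgroup B G" "B \<subseteq> A" "fin_cosets G A B" "torsion_free G B"
    and vr: "virtual_retraction G K B f"
    by auto
  have c: "c \<in> C" using insert.prems by blast
  note Cc = subgroup_closed[OF C] and Ac = subgroup_closed[OF A(1)] and Bc = subgroup_closed[OF B(1)]
  have K: "subgroup K G" "fin_cosets G (carrier G) K" "B \<subseteq> K"
    and f: "f \<in> hom (G\<lparr>carrier := K\<rparr>) G" "f ` K \<subseteq> B" "\<And>b. b \<in> B \<Longrightarrow> f b = b"
    using vr unfolding virtual_retraction_def by auto
  note Kc = subgroup_closed[OF K(1)] and fh = hom_subgroup[OF K(1) f(1)]
  have car: "c \<in> carrier G" using Cc(4) c .
  note gc = generate_singleton[OF car]
  have gen_C: "generate G {x} \<subseteq> C" if "x \<in> C" for x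
    using generate_singleton(3)[OF Cc(4)[OF that]] Cc(6)[OF that] by auto
  have sub_mult: "subgroup (P <#> Q) G" "P <#> Q \<subseteq> C"
    if "subgroup P G" "subgroup Q G" "P \<subseteq> C" "Q \<subseteq> C" for P Q
  proof -
    show "subgroup (P <#> Q) G"
    proof (rule subgroup_set_mult[OF that(1,2)])
      fix a b assume ab: "a \<in> P" "b \<in> Q"
      then have "b \<otimes> a = a \<otimes> b" using comm that by blast
      then show "b \<otimes> a \<otimes> inv b \<in> P" using ab that Cc(4) by (simp add: m_assoc subset_iff)
    qed
    show "P <#> Q \<subseteq> C" using that Cc(2) by (auto simp: set_mult_def)
  qed
  define A' where "A' = A <#> generate G {c}"
  have A': "subgroup A' G" "A' \<subseteq> C"
    using sub_mult[OF A(1) gc(1) A(3) gen_C[OF c]] unfolding A'_def by auto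
  have AA': "A \<subseteq> A'" "c \<in> A'" using mem_set_mult(1,2)[OF A(1) gc(1)] gc(2) unfolding A'_def by auto
  have fc_A': "fin_cosets G A' D"
    if "fin_cosets G A E" "subgroup D G" "E \<subseteq> D" "c [^] n \<in> D" "n > 0" for D E and n :: nat
    unfolding A'_def using fin_cosets_adjoin[OF C comm A(1,3) that(1-3) c that(4,5)] .
  have UA': "insert c U \<subseteq> A'" using A(2) AA' by blast
  \<comment> \<open>Indices of power images are tracked because averaging will later give only a
    power map. The image of \<open>A'\<close> contains that of \<open>A\<close> and also
    \<open>c [^] n\<close>, so adjoining \<open>c\<close> keeps its index finite.\<close>
  have powA': "fin_cosets G A' ((\<lambda>x. x [^] n) ` A')" if n: "n > 0" for n :: nat
  proof (rule fc_A'[OF pow[OF n]])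
    show "subgroup ((\<lambda>x. x [^] n) ` A') G"
      by (rule hom_image_subgroup[OF A'(1)], rule pow_hom[OF A'(1)]) (use comm A'(2) in blast)
  qed (use AA' n in auto)
  obtain j :: nat where j: "j > 0" "c [^] j \<in> K" using fin_cosets_pow[OF K(2) subgroup_self car] .
  define b where "b = f (c [^] j)"
  define d where "d = c [^] j \<otimes> inv b"
  have b: "b \<in> B" "b \<in> K" "b \<in> A" "b \<in> C"
    using f(2) j(2) K(3) B(2) A(3) unfolding b_def by auto
  have cj: "c [^] j \<in> A'" "c [^] j \<in> C" using subgroup_closed(5)[OF A'(1) AA'(2)] Cc(5)[OF c] by auto
  have d: "d \<in> A'" "d \<in> C" "d \<in> K" "d \<in> carrier G" "f d = \<one>" "c [^] j = d \<otimes> b"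
  proof -
    show "d \<in> A'" using subgroup_closed(2,3)[OF A'(1)] cj b(3) AA'(1) unfolding d_def by blast
    then show "d \<in> C" using A'(2) by blast
    show "d \<in> K" using Kc(2,3) j(2) b(2) unfolding d_def by blast
    then show "d \<in> carrier G" by (rule Kc(4))
    show "f d = \<one>" using j(2) b fh Kc(3,4) f(3)[OF b(1)] unfolding d_def
      by (simp add: b_def[symmetric])
    show "c [^] j = d \<otimes> b" using b(2) Kc(4) car unfolding d_def by (simp add: m_assoc)
  qed
  note gd = generate_singleton[OF d(4)]
  show ?case
  proof (cases "ord d = 0")
    \<comment> \<open>If \<open>d\<close> has finite order, then raising
      \<open>c [^] j = d \<otimes> b\<close> to the power \<open>ord d\<close> leaves a power of
      \<open>b\<close>. So a power of \<open>c\<close> lies in \<open>B\<close>, and the old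
      retraction also serves for \<open>A'\<close>.\<close>
    case False
    have "c [^] (j * ord d) = (d \<otimes> b) [^] ord d" using d(6) nat_pow_pow[OF car, of j "ord d"] by simp
    also have "\<dots> = b [^] ord d"
      using pow_mult_distrib[OF comm[OF d(2) b(4)] d(4)] Cc(4)[OF b(4)] d(4) by simp
    finally have "c [^] (j * ord d) \<in> B" using Bc(5)[OF b(1)] by simp
    then have "fin_cosets G A' B" using fc_A'[OF B(3,1) order_refl] j(1) False by simp
    moreover have "B \<subseteq> A'" using B(2) AA'(1) by blast
    ultimately show ?thesis using A' UA' powA' B(1,4) vr by blast
  next
    case True
    obtain L r where Lr: "virtual_retraction G L (generate G {d}) r" using VRC_cyclic[OF vrc d(4)] .
    then have L: "subgroup L G" "fin_cosets G (carrier G) L" "generate G {d} \<subseteq> L"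
      and r: "r \<in> hom (G\<lparr>carrier := L\<rparr>) G" "r ` L \<subseteq> generate G {d}"
        "\<And>b. b \<in> generate G {d} \<Longrightarrow> r b = b"
      unfolding virtual_retraction_def by auto
    note Lc = subgroup_closed[OF L(1)] and rh = hom_subgroup[OF L(1) r(1)]
    \<comment> \<open>The map \<open>r\<close> is defined only on \<open>L\<close>. Hence
      \<open>B\<close> is cut down to \<open>L\<close>, and the domain \<open>M\<close> of the new
      map asks for both \<open>k\<close> and \<open>f k\<close> in \<open>L\<close>; both
      restrictions cost only finite index.\<close>
    define B0 where "B0 = B \<inter> L"
    have B0: "subgroup B0 G" "B0 \<subseteq> C"
      using subgroups_Inter_pair[OF B(1) L(1)] B(2) A(3) unfolding B0_def by auto
    define B' where "B' = B0 <#> generate G {d}"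
    define M where "M = {k \<in> K. k \<in> L \<and> f k \<in> L}"
    define \<psi> where "\<psi> = (\<lambda>k. f k \<otimes> (r k \<otimes> inv (r (f k))))"
    have B': "subgroup B' G" using sub_mult(1)[OF B0(1) gd(1) B0(2) gen_C[OF d(2)]] unfolding B'_def .
    have B0B': "B0 \<subseteq> B'" "d \<in> B'" using mem_set_mult(1,2)[OF B0(1) gd(1)] gd(2) unfolding B'_def by auto
    have B'E: thesis if "x \<in> B'" "\<And>a i. a \<in> B0 \<Longrightarrow> x = a \<otimes> d [^] (i::int) \<Longrightarrow> thesis" for x thesis
      using that gd(3) unfolding B'_def set_mult_def by auto
    have B'A': "B' \<subseteq> A'"
    proof
      fix x assume "x \<in> B'"
      then obtain a i where "a \<in> B0" "x = a \<otimes> d [^] (i::int)" by (rule B'E)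
      then show "x \<in> A'"
        using subgroup_closed(2)[OF A'(1)] subgroup_closed(6)[OF A'(1) d(1)] B(2) AA'(1)
        unfolding B0_def by blast
    qed
    have BB0: "fin_cosets G B B0"
      using fin_cosets_restrict[OF L(2) _ B(1)] Bc(4) unfolding B0_def by blast
    \<comment> \<open>Two stages: the product \<open>?D\<close> of \<open>B\<close> with the powers
      of \<open>d\<close> contains \<open>c [^] j\<close> and so has finite index in
      \<open>A'\<close>. Replacing \<open>B\<close> by \<open>B0\<close> keeps \<open>d\<close>
      itself, so the exponent 1 suffices in the second stage.\<close>
    have fcA'B': "fin_cosets G A' B'"
    proof (rule fin_cosets_trans)
      let ?D = "B <#> generate G {d}"
      have BC: "B \<subseteq> C" using B(2) A(3) by blast
      have D: "subgroup ?D G" using sub_mult(1)[OF B(1) gd(1) BC gen_C[OF d(2)]] .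
      have "c [^] j = b \<otimes> d" using d(6) comm[OF d(2) b(4)] by simp
      then have "c [^] j \<in> ?D" using mem_set_mult(3)[OF B(1) gd(1) b(1) gd(2)] by simp
      then show "fin_cosets G A' ?D"
        by (rule fc_A'[OF B(3) D _ _ j(1), rotated]) (use mem_set_mult(1)[OF B(1) gd(1)] in blast)
      show "fin_cosets G ?D B'"
        by (rule fin_cosets_adjoin[where n = 1, OF C comm B(1) BC BB0 B' B0B'(1) d(2)])
          (use B0B'(2) d(4) in auto)
      show "A' \<subseteq> carrier G" using A'(2) Cc(4) by blast
    qed
    have M: "subgroup M G"
      by (rule subgroupI) (use Kc Lc fh in \<open>auto simp: M_def\<close>)
    have fcM: "fin_cosets G (carrier G) M"
    proof -
      have "fin_cosets G (carrier G) {k \<in> K. f k \<in> L}"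
        by (rule fin_cosets_trans[OF K(2) fin_cosets_vimage[OF K(1) f(1) L(2)]]) (use fh(1) in auto)
      then have "fin_cosets G (carrier G) ({k \<in> K. f k \<in> L} \<inter> L)"
        using L(2) by (rule fin_cosets_Int)
      moreover have "{k \<in> K. f k \<in> L} \<inter> L = M" unfolding M_def by auto
      ultimately show ?thesis by simp
    qed
    have rC: "r k \<in> C" if "k \<in> L" for k using r(2) gen_C[OF d(2)] that by blast
    have fC: "f k \<in> C" if "k \<in> K" for k using f(2) B(2) A(3) that by blast
    have \<psi>_hom: "\<psi> \<in> hom (G\<lparr>carrier := M\<rparr>) G"
    proof (rule homI)
      fix x assume "x \<in> carrier (G\<lparr>carrier := M\<rparr>)"
      then show "\<psi> x \<in> carrier G" using fh(1) rh(1) by (auto simp: \<psi>_def M_def)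
    next
      fix x y assume "x \<in> carrier (G\<lparr>carrier := M\<rparr>)" "y \<in> carrier (G\<lparr>carrier := M\<rparr>)"
      then have x: "x \<in> K" "x \<in> L" "f x \<in> L" and y: "y \<in> K" "y \<in> L" "f y \<in> L"
        unfolding M_def by auto
      interpret Cg: comm_group "G\<lparr>carrier := C\<rparr>"
        by (rule group.group_comm_groupI[OF subgroup_imp_group[OF C]]) (simp add: comm)
      have lc: "u \<otimes> (v \<otimes> w) = v \<otimes> (u \<otimes> w)" if "u \<in> C" "v \<in> C" "w \<in> C" for u v w
        using Cg.m_lcomm that by simp
      have "\<psi> (x \<otimes> y) = (f x \<otimes> f y) \<otimes> ((r x \<otimes> r y) \<otimes> (inv (r (f y)) \<otimes> inv (r (f x))))"
        using x y fh rh unfolding \<psi>_def by (simp add: inv_mult_group)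
      also have "\<dots> = \<psi> x \<otimes> \<psi> y"
        using x y fC rC Cc unfolding \<psi>_def by (simp add: m_assoc lc comm)
      finally show "\<psi> (x \<otimes>\<^bsub>G\<lparr>carrier := M\<rparr>\<^esub> y) = \<psi> x \<otimes>\<^bsub>G\<^esub> \<psi> y" by simp
    qed
    have \<psi>_im: "\<psi> ` M \<subseteq> B'"
    proof
      fix y assume "y \<in> \<psi> ` M"
      then obtain k where k: "y = \<psi> k" "k \<in> K" "k \<in> L" "f k \<in> L" unfolding M_def by auto
      have "f k \<in> B0" using k f(2) unfolding B0_def by auto
      moreover have "r k \<otimes> inv (r (f k)) \<in> generate G {d}"
        using k r(2) subgroup_closed(2,3)[OF gd(1)] by blast
      ultimately show "y \<in> B'"
        unfolding k(1) \<psi>_def B'_def by (rule mem_set_mult(3)[OF B0(1) gd(1)])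
    qed
    \<comment> \<open>On \<open>B0\<close> the map \<open>f\<close> is the identity and the two
      values of \<open>r\<close> cancel; at \<open>d\<close> the value of \<open>f\<close> is
      \<open>\<one>\<close> and only \<open>r d = d\<close> remains.\<close>
    have B0M: "b \<in> M" "\<psi> b = b" if "b \<in> B0" for b
    proof -
      have b: "b \<in> B" "b \<in> L" "b \<in> K" using that K(3) unfolding B0_def by auto
      show "b \<in> M" using b f(3) unfolding M_def by simp
      show "\<psi> b = b" using b f(3) rh(1) Bc(4) unfolding \<psi>_def by simp
    qed
    have dM: "d \<in> M" "\<psi> d = d"
    proof -
      have "d \<in> L" using gd(2) L(3) by blast
      then show "d \<in> M" using d(3,5) Lc(1) unfolding M_def by simp
      show "\<psi> d = d" using d(4,5) r(3)[OF gd(2)] rh(3) unfolding \<psi>_def by simp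
    qed
    have B'M: "x \<in> M \<and> \<psi> x = x" if "x \<in> B'" for x
    proof -
      obtain a i where a: "a \<in> B0" "x = a \<otimes> d [^] (i::int)" using B'E[OF \<open>x \<in> B'\<close>] by blast
      note \<psi>h = hom_subgroup[OF M \<psi>_hom] and Mc = subgroup_closed[OF M]
      show ?thesis using a B0M[OF a(1)] dM Mc(6)[OF dM(1), of i] \<psi>h(6)[OF dM(1), of i] Mc(2) \<psi>h(2) by simp
    qed
    \<comment> \<open>Applying \<open>f\<close> to \<open>a \<otimes> d [^] i\<close> returns
      \<open>a\<close>, because \<open>f d = \<one>\<close>. So a torsion element has
      \<open>a = \<one>\<close> by torsion-freeness of \<open>B\<close>, and then
      \<open>i = 0\<close> by the infinite order of \<open>d\<close>.\<close>
    have tf: "torsion_free G B'"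
      unfolding torsion_free_def
    proof (intro ballI allI impI)
      fix x and n :: nat assume x: "x \<in> B'" "n > 0" "x [^] n = \<one>"
      obtain a i where a: "a \<in> B0" "x = a \<otimes> d [^] (i::int)" using B'E[OF x(1)] by blast
      have aB: "a \<in> B" "a \<in> K" using a(1) K(3) unfolding B0_def by auto
      have di: "d [^] i \<in> K" using Kc(6)[OF d(3)] .
      have "f x = a" using a(2) fh(2)[OF aB(2) di] fh(6)[OF d(3)] d(5) f(3)[OF aB(1)] Bc(4)[OF aB(1)] by simp
      moreover have "x \<in> K" using a(2) Kc(2)[OF aB(2) di] by simp
      ultimately have "a [^] n = \<one>" using fh(5)[of x n] fh(3) x(3) by simp
      then have a1: "a = \<one>" using B(4) aB(1) x(2) unfolding torsion_free_def by blast
      then have "d [^] (i * int n) = \<one>"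
        using x(3) a(2) d(4) int_pow_pow[OF d(4), of i "int n"] by (simp add: int_pow_int)
      then have "i = 0" using int_pow_eq_id[OF d(4), of "i * int n"] True x(2) by simp
      then show "x = \<one>" using a1 a(2) by simp
    qed
    have "virtual_retraction G M B' \<psi>"
      unfolding virtual_retraction_def using M fcM \<psi>_hom \<psi>_im B'M by blast
    then show ?thesis using A' UA' powA' B' B'A' fcA'B' tf by blast
  qed
qed

section \<open>Averaging over a finite quotient\<close>

text \<open>Conjugation by \<open>h\<close> is multiplicative and preserves the abelian group
  \<open>C\<close>, so it distributes over products; for infinite \<open>I\<close> both products are
  \<open>\<one>\<close> by convention.\<close>

lemma conj_finprod:
  assumes C: "subgroup C G" and comm: "\<And>x y. x \<in> C \<Longrightarrow> y \<in> C \<Longrightarrow> x \<otimes> y = y \<otimes> x"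
    and h: "h \<in> carrier G" "\<And>c. c \<in> C \<Longrightarrow> h \<otimes> c \<otimes> inv h \<in> C"
    and F: "F \<in> I \<rightarrow> C"
  shows "finprod (G\<lparr>carrier := C\<rparr>) (\<lambda>i. h \<otimes> F i \<otimes> inv h) I =
    h \<otimes> finprod (G\<lparr>carrier := C\<rparr>) F I \<otimes> inv h"
proof -
  interpret Cg: comm_group "G\<lparr>carrier := C\<rparr>"
    by (rule group.group_comm_groupI[OF subgroup_imp_group[OF C]]) (simp add: comm)
  note Cc = subgroup_closed[OF C]
  show ?thesis using F
  proof (induction I rule: infinite_finite_induct)
    case (insert i I)
    then have Fi: "F i \<in> C" and FI: "F \<in> I \<rightarrow> C" by auto
    have P: "finprod (G\<lparr>carrier := C\<rparr>) F I \<in> C" using Cg.finprod_closed[of F I] FI by simp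
    have cF: "(\<lambda>i. h \<otimes> F i \<otimes> inv h) \<in> I \<rightarrow> C" using FI h(2) by auto
    have "finprod (G\<lparr>carrier := C\<rparr>) (\<lambda>i. h \<otimes> F i \<otimes> inv h) (insert i I) =
        (h \<otimes> F i \<otimes> inv h) \<otimes> (h \<otimes> finprod (G\<lparr>carrier := C\<rparr>) F I \<otimes> inv h)"
      using Cg.finprod_insert[OF insert.hyps, of "\<lambda>i. h \<otimes> F i \<otimes> inv h"] cF h(2)[OF Fi] insert.IH[OF FI]
      by simp
    also have "\<dots> = h \<otimes> (F i \<otimes> finprod (G\<lparr>carrier := C\<rparr>) F I) \<otimes> inv h"
      using h(1) Fi P Cc(4) by (simp add: m_assoc)
    also have "F i \<otimes> finprod (G\<lparr>carrier := C\<rparr>) F I = finprod (G\<lparr>carrier := C\<rparr>) F (insert i I)"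
      using Cg.finprod_insert[OF insert.hyps, of F] FI Fi by simp
    finally show ?case .
  qed (use h(1) in simp_all)
qed

text \<open>
  The Maschke average of \<open>\<phi>\<close> over \<open>H / E\<close>. Dividing by the number \<open>n\<close> of cosets is impossible in \<open>C\<close>,
  so the result is the \<open>n\<close>-th power map on \<open>E\<close> rather than the identity.
\<close>

lemma equivariant_average:
  assumes H: "subgroup H G"
    and C: "subgroup C G" and comm: "\<And>x y. x \<in> C \<Longrightarrow> y \<in> C \<Longrightarrow> x \<otimes> y = y \<otimes> x"
    and CH: "\<And>c h. c \<in> C \<Longrightarrow> h \<in> H \<Longrightarrow> h \<otimes> c \<otimes> inv h \<in> C"
    and K: "subgroup K G" and KH: "\<And>k h. k \<in> K \<Longrightarrow> h \<in> H \<Longrightarrow> h \<otimes> k \<otimes> inv h \<in> K"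
    and \<phi>: "\<phi> \<in> hom (G\<lparr>carrier := K\<rparr>) G" "\<phi> ` K \<subseteq> C"
    and E: "subgroup E G" "E \<subseteq> H" "E \<subseteq> C" "E \<subseteq> K" "fin_cosets G H E"
    and EH: "\<And>e h. e \<in> E \<Longrightarrow> h \<in> H \<Longrightarrow> h \<otimes> e \<otimes> inv h \<in> E"
    and \<phi>E: "\<And>e. e \<in> E \<Longrightarrow> \<phi> e = e"
  obtains \<Phi> and n :: nat where "n > 0" "\<Phi> \<in> hom (G\<lparr>carrier := K\<rparr>) G" "\<Phi> ` K \<subseteq> C"
    "\<And>e. e \<in> E \<Longrightarrow> \<Phi> e = e [^] n"
    "\<And>k h. k \<in> K \<Longrightarrow> h \<in> H \<Longrightarrow> \<Phi> (h \<otimes> k \<otimes> inv h) = h \<otimes> \<Phi> k \<otimes> inv h"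
proof -
  note Hc = subgroup_closed[OF H] and Cc = subgroup_closed[OF C] and Kc = subgroup_closed[OF K]
    and Ec = subgroup_closed[OF E(1)] and \<phi>h = hom_subgroup[OF K \<phi>(1)]
  interpret Cg: comm_group "G\<lparr>carrier := C\<rparr>"
    by (rule group.group_comm_groupI[OF subgroup_imp_group[OF C]]) (simp add: comm)
  have KH': "inv h \<otimes> k \<otimes> h \<in> K" if "k \<in> K" "h \<in> H" for k h
    using KH[OF that(1) Hc(3)[OF that(2)]] Hc(4)[OF that(2)] by simp
  have EH': "inv h \<otimes> e \<otimes> h \<in> E" if "e \<in> E" "h \<in> H" for e h
    using EH[OF that(1) Hc(3)[OF that(2)]] Hc(4)[OF that(2)] by simp
  \<comment> \<open>\<open>F k x\<close> is the value at \<open>k\<close> of the conjugate of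
    \<open>\<phi>\<close> by \<open>x\<close>.\<close>
  define F where "F = (\<lambda>k x. x \<otimes> \<phi> (inv x \<otimes> k \<otimes> x) \<otimes> inv x)"
  have FC: "F k x \<in> C" if "k \<in> K" "x \<in> H" for k x
    using CH[OF _ that(2)] \<phi>(2) KH'[OF that] unfolding F_def by blast
  \<comment> \<open>The factor depends only on the coset of \<open>x\<close> modulo
    \<open>E\<close>: as \<open>\<phi>\<close> fixes \<open>e'\<close>, conjugating the argument by
    \<open>e'\<close> conjugates the value, and this has no effect because \<open>e'\<close> and the
    value both lie in the abelian group \<open>C\<close>. The outer conjugation by \<open>e\<close>
    disappears in the same way.\<close>
  have F_coset: "F k (e \<otimes> x) = F k x" if k: "k \<in> K" and e: "e \<in> E" and x: "x \<in> H" for k e x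
  proof -
    define e' where "e' = inv x \<otimes> e \<otimes> x"
    define l where "l = inv x \<otimes> k \<otimes> x"
    have e': "e' \<in> E" "e' \<in> K" and l: "l \<in> K"
      using EH'[OF e x] KH'[OF k x] E(4) unfolding e'_def l_def by auto
    have car: "k \<in> carrier G" "e \<in> carrier G" "x \<in> carrier G"
      using Kc(4)[OF k] Ec(4)[OF e] Hc(4)[OF x] by auto
    have "inv (e \<otimes> x) \<otimes> k \<otimes> (e \<otimes> x) = inv e' \<otimes> l \<otimes> e'"
      unfolding e'_def l_def using car by (simp add: inv_mult_group m_assoc)
    moreover have "\<phi> (inv e' \<otimes> l \<otimes> e') = inv e' \<otimes> \<phi> l \<otimes> e'"
      using \<phi>h Kc(2,3) e' l \<phi>E[OF e'(1)] by simp
    moreover have "inv e' \<otimes> \<phi> l \<otimes> e' = \<phi> l"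
    proof -
      have "\<phi> l \<in> C" "e' \<in> C" using \<phi>(2) l e'(1) E(3) by auto
      then have "inv e' \<otimes> \<phi> l \<otimes> e' = inv e' \<otimes> (e' \<otimes> \<phi> l)"
        using comm[of "\<phi> l" e'] Cc(4) by (simp add: m_assoc)
      then show ?thesis using \<open>\<phi> l \<in> C\<close> \<open>e' \<in> C\<close> Cc(4) by simp
    qed
    ultimately have "F k (e \<otimes> x) = (e \<otimes> x) \<otimes> \<phi> l \<otimes> inv (e \<otimes> x)" unfolding F_def by simp
    also have "\<dots> = (e \<otimes> F k x) \<otimes> inv e"
      unfolding F_def l_def[symmetric] using car \<phi>h(1)[OF l] by (simp add: inv_mult_group m_assoc)
    also have "e \<otimes> F k x = F k x \<otimes> e" using comm FC[OF k x] e E(3) by blast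
    also have "(F k x \<otimes> e) \<otimes> inv e = F k x" using Cc(4)[OF FC[OF k x]] car by (simp add: m_assoc)
    finally show ?thesis .
  qed
  define I where "I = (\<lambda>x. E #> x) ` H"
  define r where "r = (\<lambda>S. SOME x. x \<in> H \<and> E #> x = S)"
  have "finite_index (G\<lparr>carrier := H\<rparr>) E" using finite_index_iff[OF H E(1,2)] E(5) by simp
  moreover have "rcosets\<^bsub>G\<lparr>carrier := H\<rparr>\<^esub> E = I" by (auto simp: RCOSETS_def r_coset_def I_def)
  ultimately have finI: "finite I" unfolding finite_index_def by simp
  have r: "r S \<in> H" "E #> r S = S" if "S \<in> I" for S
    using someI_ex[of "\<lambda>x. x \<in> H \<and> E #> x = S"] that unfolding r_def I_def by auto
  have F_rep: "F k (r (E #> x)) = F k x" if k: "k \<in> K" and x: "x \<in> H" for k x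
  proof -
    have "E #> x \<in> I" using x unfolding I_def by blast
    note rx = r[OF this]
    have "r (E #> x) \<in> E #> x" using rcos_self[OF Hc(4)[OF rx(1)] E(1)] rx(2) by simp
    then obtain e where "e \<in> E" "r (E #> x) = e \<otimes> x" by (auto simp: r_coset_def)
    then show ?thesis using F_coset[OF k _ x] by simp
  qed
  define \<Phi> where "\<Phi> = (\<lambda>k. finprod (G\<lparr>carrier := C\<rparr>) (\<lambda>S. F k (r S)) I)"
  have Fr: "(\<lambda>S. F k (r S)) \<in> I \<rightarrow> C" if "k \<in> K" for k using FC that r by auto
  have \<Phi>C: "\<Phi> k \<in> C" if "k \<in> K" for k
    using Cg.finprod_closed[of "\<lambda>S. F k (r S)" I] Fr[OF that] unfolding \<Phi>_def by simp
  have "card I > 0" using finI Hc(1) unfolding I_def by (auto simp: card_gt_0_iff)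
  moreover have "\<Phi> \<in> hom (G\<lparr>carrier := K\<rparr>) G"
  proof (rule homI)
    fix k assume "k \<in> carrier (G\<lparr>carrier := K\<rparr>)"
    then show "\<Phi> k \<in> carrier G" using \<Phi>C Cc(4) by simp
  next
    fix k l assume "k \<in> carrier (G\<lparr>carrier := K\<rparr>)" "l \<in> carrier (G\<lparr>carrier := K\<rparr>)"
    then have k: "k \<in> K" and l: "l \<in> K" by auto
    have Fm: "F (k \<otimes> l) x = F k x \<otimes> F l x" if x: "x \<in> H" for x
    proof -
      have "inv x \<otimes> (k \<otimes> l) \<otimes> x = (inv x \<otimes> k \<otimes> x) \<otimes> (inv x \<otimes> l \<otimes> x)"
        using Kc(4)[OF k] Kc(4)[OF l] Hc(4)[OF x] by (simp add: m_assoc)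
      then have "\<phi> (inv x \<otimes> (k \<otimes> l) \<otimes> x) = \<phi> (inv x \<otimes> k \<otimes> x) \<otimes> \<phi> (inv x \<otimes> l \<otimes> x)"
        using \<phi>h(2)[OF KH'[OF k x] KH'[OF l x]] by simp
      then show ?thesis unfolding F_def
        using \<phi>h(1)[OF KH'[OF k x]] \<phi>h(1)[OF KH'[OF l x]] Hc(4)[OF x] by (simp add: m_assoc)
    qed
    have "\<Phi> (k \<otimes> l) = finprod (G\<lparr>carrier := C\<rparr>) (\<lambda>S. F k (r S) \<otimes> F l (r S)) I"
      unfolding \<Phi>_def
      by (rule Cg.finprod_cong') (use Fm r Fr[OF k] Fr[OF l] Cc(2) in \<open>auto simp: Pi_def\<close>)
    also have "\<dots> = \<Phi> k \<otimes> \<Phi> l"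
      using Cg.finprod_multf[of "\<lambda>S. F k (r S)" I "\<lambda>S. F l (r S)"] Fr[OF k] Fr[OF l]
      unfolding \<Phi>_def by simp
    finally show "\<Phi> (k \<otimes>\<^bsub>G\<lparr>carrier := K\<rparr>\<^esub> l) = \<Phi> k \<otimes>\<^bsub>G\<^esub> \<Phi> l" by simp
  qed
  moreover have "\<Phi> ` K \<subseteq> C" using \<Phi>C by auto
  moreover have "\<Phi> e = e [^] card I" if e: "e \<in> E" for e
  proof -
    \<comment> \<open>The conjugate of \<open>e\<close> by \<open>inv x\<close> stays in
      \<open>E\<close>, where \<open>\<phi>\<close> is the identity; so all \<open>card I\<close>
      factors are equal to \<open>e\<close>.\<close>
    have "F e x = e" if x: "x \<in> H" for x
      using \<phi>E[OF EH'[OF e x]] Ec(4)[OF e] Hc(4)[OF x] unfolding F_def by (simp add: m_assoc)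
    then have "\<Phi> e = finprod (G\<lparr>carrier := C\<rparr>) (\<lambda>S. e) I"
      unfolding \<Phi>_def by (intro Cg.finprod_cong') (use r e E(3) in auto)
    also have "\<dots> = e [^] card I"
      using Cg.finprod_const[of e I] e E(3) by (simp add: nat_pow_consistent[symmetric] subset_iff)
    finally show ?thesis .
  qed
  moreover have "\<Phi> (h \<otimes> k \<otimes> inv h) = h \<otimes> \<Phi> k \<otimes> inv h" if k: "k \<in> K" and h: "h \<in> H" for k h
  proof -
    \<comment> \<open>Left translation by \<open>inv h\<close> permutes the cosets because
      \<open>E\<close> is normal in \<open>H\<close>. The factor of
      \<open>h \<otimes> k \<otimes> inv h\<close> at \<open>S\<close> is the conjugate by
      \<open>h\<close> of the factor of \<open>k\<close> at \<open>\<sigma> S\<close>, so reindexing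
      the product gives equivariance.\<close>
    define \<sigma> where "\<sigma> = (\<lambda>S. E #> (inv h \<otimes> r S))"
    have hr: "inv h \<otimes> r S \<in> H" if "S \<in> I" for S using Hc(2,3) h r(1)[OF that] by blast
    have \<sigma>I: "\<sigma> ` I \<subseteq> I" using hr unfolding \<sigma>_def I_def by blast
    have "inj_on \<sigma> I"
    proof (rule inj_onI)
      fix S T assume S: "S \<in> I" and T: "T \<in> I" and "\<sigma> S = \<sigma> T"
      then have "inv h \<otimes> r S \<in> E #> (inv h \<otimes> r T)"
        using rcos_self[OF Hc(4)[OF hr[OF S]] E(1)] unfolding \<sigma>_def by simp
      then obtain e where e: "e \<in> E" "inv h \<otimes> r S = e \<otimes> (inv h \<otimes> r T)" by (auto simp: r_coset_def)
      have "r S = h \<otimes> (inv h \<otimes> r S)" using Hc(4) h r(1)[OF S] by simp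
      also have "\<dots> = (h \<otimes> e \<otimes> inv h) \<otimes> r T"
        using e Hc(4) Ec(4) h r(1)[OF T] by (simp add: m_assoc)
      finally have "r S \<in> E #> r T" using EH[OF e(1) h] by (auto simp: r_coset_def)
      then have "E #> r T = E #> r S" using repr_independence Hc(4)[OF r(1)[OF T]] E(1) by blast
      then show "S = T" using r(2) S T by simp
    qed
    then have \<sigma>: "inj_on \<sigma> I" "\<sigma> ` I = I" using endo_inj_surj[OF finI \<sigma>I] by auto
    have Fh: "F (h \<otimes> k \<otimes> inv h) (r S) = h \<otimes> F k (r (\<sigma> S)) \<otimes> inv h" if S: "S \<in> I" for S
    proof -
      define x where "x = r S"
      have car: "x \<in> carrier G" "h \<in> carrier G" "k \<in> carrier G" "x \<in> H"
        using Hc(4) Kc(4) h k r(1)[OF S] unfolding x_def by auto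
      have "F k (r (\<sigma> S)) = F k (inv h \<otimes> x)"
        using F_rep[OF k hr[OF S]] unfolding \<sigma>_def x_def .
      moreover have "inv (inv h \<otimes> x) \<otimes> k \<otimes> (inv h \<otimes> x) = inv x \<otimes> (h \<otimes> k \<otimes> inv h) \<otimes> x"
        using car by (simp add: inv_mult_group m_assoc)
      moreover have "\<phi> (inv x \<otimes> (h \<otimes> k \<otimes> inv h) \<otimes> x) \<in> carrier G"
        using \<phi>h(1)[OF KH'[OF KH[OF k h] car(4)]] .
      ultimately show ?thesis
        unfolding F_def x_def[symmetric] using car by (simp add: inv_mult_group m_assoc)
    qed
    have "\<Phi> (h \<otimes> k \<otimes> inv h) = finprod (G\<lparr>carrier := C\<rparr>) (\<lambda>S. h \<otimes> F k (r (\<sigma> S)) \<otimes> inv h) I"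
      unfolding \<Phi>_def
      by (rule Cg.finprod_cong') (use Fh CH[OF _ h] Fr[OF k] \<sigma>I in \<open>auto simp: Pi_def\<close>)
    also have "\<dots> = finprod (G\<lparr>carrier := C\<rparr>) (\<lambda>S. h \<otimes> F k (r S) \<otimes> inv h) (\<sigma> ` I)"
      using Cg.finprod_reindex[of "\<lambda>S. h \<otimes> F k (r S) \<otimes> inv h" \<sigma> I] \<sigma> CH[OF _ h] Fr[OF k]
      by (auto simp: Pi_def)
    also have "\<dots> = h \<otimes> \<Phi> k \<otimes> inv h"
      unfolding \<sigma>(2) \<Phi>_def
      by (rule conj_finprod[OF C comm Hc(4)[OF h]]) (use CH h Fr[OF k] in auto)
    finally show ?thesis .
  qed
  ultimately show ?thesis using that by blast
qed

section \<open>Complements and the final assembly\<close>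

text \<open>The retraction sends \<open>m \<otimes> h\<close> to \<open>h\<close>. It is well
  defined because two factorisations of one element differ by an element of
  \<open>M \<inter> H\<close>, and multiplicative because \<open>H\<close> normalises
  \<open>M\<close>.\<close>

lemma virtual_retract_complement:
  assumes H: "subgroup H G" and M: "subgroup M G"
    and MH: "\<And>m h. m \<in> M \<Longrightarrow> h \<in> H \<Longrightarrow> h \<otimes> m \<otimes> inv h \<in> M"
    and triv: "M \<inter> H \<subseteq> {\<one>}" and fc: "fin_cosets G (carrier G) (M <#> H)"
  shows "virtual_retract G H"
proof -
  note Hc = subgroup_closed[OF H] and Mc = subgroup_closed[OF M]
  let ?K = "M <#> H"
  have K: "subgroup ?K G" by (rule subgroup_set_mult[OF M H MH])
  have HK: "H \<subseteq> ?K" using mem_set_mult(2)[OF M H] by blast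
  have unique: "h = h'" if "m \<in> M" "h \<in> H" "m' \<in> M" "h' \<in> H" "m \<otimes> h = m' \<otimes> h'" for m h m' h'
  proof -
    have car: "m \<in> carrier G" "h \<in> carrier G" "m' \<in> carrier G" "h' \<in> carrier G"
      using that Hc(4) Mc(4) by auto
    have "inv m' \<otimes> m = inv m' \<otimes> (m \<otimes> h) \<otimes> inv h" using car by (simp add: m_assoc)
    also have "\<dots> = h' \<otimes> inv h" unfolding that(5) using car by (simp add: m_assoc[symmetric])
    finally have "h' \<otimes> inv h \<in> M \<inter> H"
      using Mc(2)[OF Mc(3)[OF that(3)] that(1)] Hc(2)[OF that(4) Hc(3)[OF that(2)]] by simp
    then have "h' \<otimes> inv h = \<one>" using triv by blast
    then show ?thesis using car by (simp add: inv_solve_right')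
  qed
  define \<rho> where "\<rho> = (\<lambda>x. THE h. h \<in> H \<and> (\<exists>m\<in>M. x = m \<otimes> h))"
  have \<rho>: "\<rho> (m \<otimes> h) = h" if "m \<in> M" "h \<in> H" for m h
    unfolding \<rho>_def by (rule the_equality) (use that unique in blast)+
  have "\<rho> \<in> hom (G\<lparr>carrier := ?K\<rparr>) (G\<lparr>carrier := ?K, carrier := H\<rparr>)"
  proof (rule homI)
    fix x assume "x \<in> carrier (G\<lparr>carrier := ?K\<rparr>)"
    then show "\<rho> x \<in> carrier (G\<lparr>carrier := ?K, carrier := H\<rparr>)" using \<rho> by (auto simp: set_mult_def)
  next
    fix x y assume "x \<in> carrier (G\<lparr>carrier := ?K\<rparr>)" "y \<in> carrier (G\<lparr>carrier := ?K\<rparr>)"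
    then obtain m h m' h' where x: "x = m \<otimes> h" "m \<in> M" "h \<in> H" and y: "y = m' \<otimes> h'" "m' \<in> M" "h' \<in> H"
      by (auto simp: set_mult_def)
    have "x \<otimes> y = (m \<otimes> (h \<otimes> m' \<otimes> inv h)) \<otimes> (h \<otimes> h')"
      using x y Hc(4) Mc(4) by (simp add: m_assoc)
    then have "\<rho> (x \<otimes> y) = h \<otimes> h'"
      using \<rho>[OF Mc(2)[OF x(2) MH[OF y(2) x(3)]] Hc(2)[OF x(3) y(3)]] by simp
    then show "\<rho> (x \<otimes>\<^bsub>G\<lparr>carrier := ?K\<rparr>\<^esub> y) = \<rho> x \<otimes>\<^bsub>G\<lparr>carrier := ?K, carrier := H\<rparr>\<^esub> \<rho> y"
      using x y \<rho> by simp
  qed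
  moreover have "\<forall>h\<in>H. \<rho> h = h" using \<rho>[OF Mc(1)] Hc(4) by simp
  moreover have "subgroup H (G\<lparr>carrier := ?K\<rparr>)" using subgroup_incl[OF H K HK] .
  ultimately have "retract (G\<lparr>carrier := ?K\<rparr>) H" unfolding retract_def by blast
  then show ?thesis
    unfolding virtual_retract_def using H HK fc finite_index_iff_carrier[OF K] by blast
qed

lemma VRC_virtually_abelian:
  assumes vrc: "property_VRC G" and H: "subgroup H G"
    and S: "finite S" "S \<subseteq> carrier G" "H = generate G S"
    and C0: "subgroup C0 G" "C0 \<subseteq> H" "fin_cosets G H C0"
      "\<And>x y. x \<in> C0 \<Longrightarrow> y \<in> C0 \<Longrightarrow> x \<otimes> y = y \<otimes> x"
  shows "virtual_retract G H"
proof -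
  note Hc = subgroup_closed[OF H]
  have Hcar: "H \<subseteq> carrier G" using Hc(4) by blast
  \<comment> \<open>The normal core makes the abelian subgroup invariant under conjugation by
    \<open>H\<close>, so that averaged values stay in it.\<close>
  obtain C where C: "subgroup C G" "C \<subseteq> C0" "fin_cosets G H C"
    and CH: "\<And>c h. c \<in> C \<Longrightarrow> h \<in> H \<Longrightarrow> h \<otimes> c \<otimes> inv h \<in> C"
    using fin_cosets_core[OF H C0(1-3)] by metis
  have comm: "x \<otimes> y = y \<otimes> x" if "x \<in> C" "y \<in> C" for x y using C0(4) C(2) that by blast
  have C_H: "C \<subseteq> H" using C(2) C0(2) by blast
  \<comment> \<open>Containing \<open>U\<close> is what will give \<open>A\<close>, and with it
    \<open>B\<close>, finite index in \<open>H\<close>.\<close>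
  obtain U where U: "finite U" "U \<subseteq> C"
    and fcU: "\<And>A. subgroup A G \<Longrightarrow> U \<subseteq> A \<Longrightarrow> fin_cosets G H A"
    using fin_cosets_Schreier[OF S(1,2) C(1)] C_H C(3) unfolding S(3) by metis
  obtain A B K f where A: "subgroup A G" "U \<subseteq> A" "A \<subseteq> C"
    and pow: "\<And>n::nat. n > 0 \<Longrightarrow> fin_cosets G A ((\<lambda>x. x [^] n) ` A)"
    and B: "subgroup B G" "B \<subseteq> A" "fin_cosets G A B" "torsion_free G B"
    and vr: "virtual_retraction G K B f"
    using VRC_abelian[OF vrc C(1) comm U] by auto
  have K: "subgroup K G" "fin_cosets G (carrier G) K" "B \<subseteq> K"
    and f: "f \<in> hom (G\<lparr>carrier := K\<rparr>) G" "f ` K \<subseteq> B" "\<And>b. b \<in> B \<Longrightarrow> f b = b"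
    using vr unfolding virtual_retraction_def by auto
  have HB: "fin_cosets G H B"
    using fin_cosets_trans[OF fcU[OF A(1,2)] B(3) Hcar] .
  have B_H: "B \<subseteq> H" using B(2) A(3) C_H by blast
  note Kc = subgroup_closed[OF K(1)] and fh = hom_subgroup[OF K(1) f(1)]
  \<comment> \<open>Shrinking \<open>K\<close> to meet \<open>Q\<close> trivially makes \<open>f\<close> injective on \<open>K0 \<inter> H\<close>.\<close>
  define Q where "Q = {x \<in> K. f x = \<one>} \<inter> H"
  have Q: "subgroup Q G"
    by (rule subgroupI) (use Kc Hc fh in \<open>auto simp: Q_def\<close>)
  \<comment> \<open>\<open>f\<close> fixes \<open>B\<close>, so \<open>Q\<close> meets
    \<open>B\<close> trivially while \<open>B\<close> has finite index in \<open>H\<close>.\<close>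
  have "finite Q"
  proof (rule fin_cosets_trivial_Int[OF HB Q])
    show "Q \<inter> B \<subseteq> {\<one>}" using f(3) unfolding Q_def by auto
  qed (auto simp: Q_def)
  then obtain L where L: "subgroup L G" "fin_cosets G (carrier G) L" "L \<inter> Q \<subseteq> {\<one>}"
    using VRC_separates_finite[OF vrc] subgroup.subset[OF Q] by metis
  \<comment> \<open>The core is taken in all of \<open>G\<close>, so that \<open>H\<close> acts on
    \<open>K0\<close> by conjugation.\<close>
  obtain K0 where K0: "subgroup K0 G" "K0 \<subseteq> K \<inter> L" "fin_cosets G (carrier G) K0"
    and K0n: "\<And>k h. k \<in> K0 \<Longrightarrow> h \<in> carrier G \<Longrightarrow> h \<otimes> k \<otimes> inv h \<in> K0"
    using fin_cosets_core[OF subgroup_self subgroups_Inter_pair[OF K(1) L(1)] _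
        fin_cosets_Int[OF K(2) L(2)]] Kc(4) by (metis Int_iff subsetI)
  note K0c = subgroup_closed[OF K0(1)]
  have "fin_cosets G H (B \<inter> (H \<inter> K0))"
    by (rule fin_cosets_Int[OF HB fin_cosets_restrict[OF K0(3) Hcar H]])
  then have "fin_cosets G H (B \<inter> K0)" by (rule fin_cosets_mono) auto
  \<comment> \<open>\<open>E\<close> lies in \<open>B\<close>, where \<open>f\<close> is the
    identity and torsion is absent, and in \<open>K0\<close>, the domain of the average; passing to
    a core makes it normal in \<open>H\<close>.\<close>
  then obtain E where E: "subgroup E G" "E \<subseteq> B \<inter> K0" "fin_cosets G H E"
    and EH: "\<And>e h. e \<in> E \<Longrightarrow> h \<in> H \<Longrightarrow> h \<otimes> e \<otimes> inv h \<in> E"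
    using fin_cosets_core[OF H subgroups_Inter_pair[OF B(1) K0(1)]] B_H by (metis le_infI1)
  note Ec = subgroup_closed[OF E(1)]
  have E_C: "E \<subseteq> C" using E(2) B(2) A(3) by blast
  have K0_K: "k \<in> K" if "k \<in> K0" for k using K0(2) that by blast
  have f0: "f \<in> hom (G\<lparr>carrier := K0\<rparr>) G" "f ` K0 \<subseteq> C"
  proof -
    show "f \<in> hom (G\<lparr>carrier := K0\<rparr>) G" using fh(1,2) K0_K by (simp add: hom_def Pi_def)
    show "f ` K0 \<subseteq> C" using K0_K f(2) B(2) A(3) by blast
  qed
  have K0H: "\<And>k h. k \<in> K0 \<Longrightarrow> h \<in> H \<Longrightarrow> h \<otimes> k \<otimes> inv h \<in> K0" using K0n Hc(4) by blast
  have E_H: "E \<subseteq> H" "E \<subseteq> K0" using E_C C_H E(2) by auto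
  have fE: "\<And>e. e \<in> E \<Longrightarrow> f e = e" using f(3) E(2) by blast
  obtain \<Phi> and n :: nat where n: "n > 0" and \<Phi>: "\<Phi> \<in> hom (G\<lparr>carrier := K0\<rparr>) G" "\<Phi> ` K0 \<subseteq> C"
    and \<Phi>E: "\<And>e. e \<in> E \<Longrightarrow> \<Phi> e = e [^] n"
    and \<Phi>H: "\<And>k h. k \<in> K0 \<Longrightarrow> h \<in> H \<Longrightarrow> \<Phi> (h \<otimes> k \<otimes> inv h) = h \<otimes> \<Phi> k \<otimes> inv h"
    by (rule equivariant_average[OF H C(1) comm CH K0(1) K0H f0 E(1) E_H(1) E_C E_H(2) E(3) EH fE])
      blast+
  note \<Phi>h = hom_subgroup[OF K0(1) \<Phi>(1)]
  define M where "M = {k \<in> K0. \<Phi> k = \<one>}"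
  have M: "subgroup M G" by (rule subgroupI) (use K0c \<Phi>h in \<open>auto simp: M_def\<close>)
  have MH: "h \<otimes> m \<otimes> inv h \<in> M" if "m \<in> M" "h \<in> H" for m h
    using that \<Phi>H[of m h] K0H[of m h] Hc(4)[of h] unfolding M_def by simp
  have ME: "x = \<one>" if "x \<in> M" "x \<in> E" for x
    using that \<Phi>E n B(4) E(2) unfolding M_def torsion_free_def by auto
  have triv: "M \<inter> H \<subseteq> {\<one>}"
  proof
    fix x assume "x \<in> M \<inter> H"
    then have x: "x \<in> M" "x \<in> H" "x \<in> K0" "x \<in> K" "x \<in> L" using K0(2) unfolding M_def by auto
    \<comment> \<open>Some power of \<open>x\<close> lies in \<open>M\<close> and in
      \<open>E\<close>, hence is \<open>\<one>\<close>. Then \<open>f x\<close> is a torsion element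
      of \<open>B\<close>, so \<open>x\<close> lies in the kernel \<open>Q\<close>, which
      \<open>L\<close> meets trivially.\<close>
    obtain j :: nat where j: "j > 0" "x [^] j \<in> E" using fin_cosets_pow[OF E(3) H x(2)] .
    have "x [^] j = \<one>" using ME[OF subgroup_closed(5)[OF M x(1)] j(2)] .
    then have "f x [^] j = \<one>" using fh(5)[OF x(4), of j] fh(3) by simp
    then have "f x = \<one>" using B(4) f(2) x(4) j(1) unfolding torsion_free_def by blast
    then have "x \<in> L \<inter> Q" using x unfolding Q_def by blast
    then show "x \<in> {\<one>}" using L(3) by blast
  qed
  let ?p = "\<lambda>x. x [^] n"
  have "?p \<in> hom (G\<lparr>carrier := A\<rparr>) G" by (rule pow_hom[OF A(1)]) (use comm A(3) in blast)
  moreover have "fin_cosets G A E" by (rule fin_cosets_mono[OF E(3)]) (use A(3) C_H in auto)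
  ultimately have "fin_cosets G (?p ` A) (?p ` E)" using fin_cosets_image[OF A(1)] by blast
  then have "fin_cosets G A (?p ` E)"
    using fin_cosets_trans[OF pow[OF n]] subgroup.subset[OF A(1)] by blast
  then have "fin_cosets G H (?p ` E)" using fin_cosets_trans[OF fcU[OF A(1,2)]] Hcar by blast
  then have "fin_cosets G K0 {k \<in> K0. \<Phi> k \<in> ?p ` E}"
    using fin_cosets_vimage[OF K0(1) \<Phi>(1)] \<Phi>(2) C_H by blast
  then have "fin_cosets G (carrier G) {k \<in> K0. \<Phi> k \<in> ?p ` E}"
    using fin_cosets_trans[OF K0(3)] by blast
  moreover have "{k \<in> K0. \<Phi> k \<in> ?p ` E} \<subseteq> M <#> H"
  proof
    fix k assume "k \<in> {k \<in> K0. \<Phi> k \<in> ?p ` E}"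
    then obtain e where k: "k \<in> K0" and e: "e \<in> E" "\<Phi> k = e [^] n" by auto
    have eK: "e \<in> K0" "e \<in> H" using e(1) E_H by auto
    \<comment> \<open>On \<open>E\<close> the map \<open>\<Phi>\<close> is the \<open>n\<close>-th
      power map, so dividing \<open>k\<close> by \<open>e\<close> lands in its kernel
      \<open>M\<close>.\<close>
    have "\<Phi> (k \<otimes> inv e) = \<one>"
      using \<Phi>h(2)[OF k K0c(3)[OF eK(1)]] \<Phi>h(4)[OF eK(1)] \<Phi>E[OF e(1)] e(2) K0c(4)[OF eK(1)] by simp
    then have "k \<otimes> inv e \<in> M" using K0c(2)[OF k K0c(3)[OF eK(1)]] unfolding M_def by simp
    moreover have "k = (k \<otimes> inv e) \<otimes> e" using K0c(4) k eK by (simp add: m_assoc)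
    ultimately show "k \<in> M <#> H" using mem_set_mult(3)[OF M H _ eK(2)] by metis
  qed
  ultimately have "fin_cosets G (carrier G) (M <#> H)" by (rule fin_cosets_mono[OF _ order_refl])
  then show ?thesis using virtual_retract_complement[OF H M MH triv] by blast
qed

end

theorem proposition1p5:
  fixes G :: "('a, 'b) monoid_scheme" and H :: "'a set"
  assumes "group G"
    and "property_VRC G"
    and "subgroup H G"
    and "finitely_generated_group (G\<lparr>carrier := H\<rparr>)"
    and "virtually_abelian (G\<lparr>carrier := H\<rparr>)"
  shows "virtual_retract G H"
proof -
  interpret group G by fact
  note H = \<open>subgroup H G\<close>
  \<comment> \<open>Generation, finite index and commutativity are given for \<open>H\<close> as a
    group of its own and are first transported to the ambient group \<open>G\<close>.\<close>
  obtain S where S: "finite S" "S \<subseteq> H" "generate (G\<lparr>carrier := H\<rparr>) S = H"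
    using assms(4) unfolding finitely_generated_group_def by auto
  have S_G: "S \<subseteq> carrier G" using S(2) subgroup.subset[OF H] by blast
  have gen: "H = generate G S" using generate_consistent[OF S(2) H] S(3) by simp
  obtain A where A: "finite_index (G\<lparr>carrier := H\<rparr>) A" "comm_group (G\<lparr>carrier := H, carrier := A\<rparr>)"
    using assms(5) unfolding virtually_abelian_def by auto
  have sA: "subgroup A (G\<lparr>carrier := H\<rparr>)" using A(1) unfolding finite_index_def by blast
  have A_H: "A \<subseteq> H" using subgroup.subset[OF sA] by simp
  have A_G: "subgroup A G" using incl_subgroup[OF H sA] .
  interpret Ag: comm_group "G\<lparr>carrier := H, carrier := A\<rparr>" by fact
  have comm: "x \<otimes>\<^bsub>G\<^esub> y = y \<otimes>\<^bsub>G\<^esub> x" if "x \<in> A" "y \<in> A" for x y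
    using Ag.m_comm that by simp
  show ?thesis
    using VRC_virtually_abelian[OF assms(2) H S(1) S_G gen A_G A_H _ comm]
      finite_index_iff[OF H A_G A_H] A(1) by blast
qed

end
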